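(* Let $G$ be a group that is indicably coherent and does not contain a non-abelian free subgroup. Then every quotient of $G$ is also indicably coherent.
   Context: An HNN extension with vertex group $A$ and stable letter $t$ is a group with presentation $\langle A,t\mid t^{-1}ct=\iota(c)\ (c\in C)\rangle$, where $C\leqslant A$ is a subgroup and $\iota\colon C\to A$ is a monomorphism; its quotient by the normal closure of $A$ is infinite cyclic, generated by the image of $t$. Given an epimorphism $\phi\colon H\to\mathbb{Z}$, a splitting of $H$ as an HNN extension with vertex group $A$ realises $\phi$ if $\phi$ coincides with the quotient map dividing $H$ by the normal closure of $A$ (identified with $\mathbb{Z}$ via a generator given by the image of the stable letter or its inverse). A group $G$ is indicably coherent if for every finitely generated subgroup $H\leqslant G$ and every epimorphism $\phi\colon H\to\mathbb{Z}$, the group $H$ splits as an HNN extension with finitely generated vertex group realising $\phi$. *)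

theory Defs
  imports "HOL-Algebra.Elementary_Groups"
begin

section \<open>Groups given by generators and relators\<close>

text \<open>A letter \<open>(x, True)\<close> stands for the generator \<open>x\<close> and \<open>(x, False)\<close> for its formal inverse.\<close>

type_synonym 'x word = "('x \<times> bool) list"

abbreviation pos :: "'x \<Rightarrow> 'x \<times> bool" where "pos x \<equiv> (x, True)"
abbreviation neg :: "'x \<Rightarrow> 'x \<times> bool" where "neg x \<equiv> (x, False)"

definition words :: "'x set \<Rightarrow> 'x word set" where
  "words X = lists (X \<times> UNIV)"

text \<open>Two words over \<open>X\<close> are identified if one can be transformed into the other by finitely many
  insertions and deletions of subwords \<open>x x\<^sup>-\<^sup>1\<close>, \<open>x\<^sup>-\<^sup>1 x\<close> (with \<open>x \<in> X\<close>) and of relators.\<close>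

inductive_set word_rel :: "'x set \<Rightarrow> 'x word set \<Rightarrow> ('x word \<times> 'x word) set"
  for X :: "'x set" and R :: "'x word set" where
  refl: "w \<in> words X \<Longrightarrow> (w, w) \<in> word_rel X R"
| sym: "(v, w) \<in> word_rel X R \<Longrightarrow> (w, v) \<in> word_rel X R"
| trans: "(u, v) \<in> word_rel X R \<Longrightarrow> (v, w) \<in> word_rel X R \<Longrightarrow> (u, w) \<in> word_rel X R"
| cancel: "u \<in> words X \<Longrightarrow> v \<in> words X \<Longrightarrow> x \<in> X
    \<Longrightarrow> (u @ [(x, b), (x, \<not> b)] @ v, u @ v) \<in> word_rel X R"
| relator: "u \<in> words X \<Longrightarrow> v \<in> words X \<Longrightarrow> r \<in> R \<Longrightarrow> r \<in> words X
    \<Longrightarrow> (u @ r @ v, u @ v) \<in> word_rel X R"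

definition presented_group :: "'x set \<Rightarrow> 'x word set \<Rightarrow> 'x word set monoid" where
  "presented_group X R =
     \<lparr>carrier = words X // word_rel X R,
      monoid.mult = (\<lambda>P Q. \<Union>p\<in>P. \<Union>q\<in>Q. word_rel X R `` {p @ q}),
      one = word_rel X R `` {[]}\<rparr>"

lemma word_rel_words: "(v, w) \<in> word_rel X R \<Longrightarrow> v \<in> words X \<and> w \<in> words X"
  by (induction rule: word_rel.induct) (auto simp: words_def)

lemma equiv_word_rel: "equiv (words X) (word_rel X R)"
  by (rule equivI)
    (auto intro!: refl_onI symI transI intro: word_rel.intros dest: word_rel_words)

lemma word_rel_append_right:
  "(v, w) \<in> word_rel X R \<Longrightarrow> u \<in> words X \<Longrightarrow> (v @ u, w @ u) \<in> word_rel X R"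
proof (induction rule: word_rel.induct)
  case (cancel a c x b)
  then show ?case using word_rel.cancel[of a X "c @ u" x b R] by (simp add: words_def)
next
  case (relator a c r)
  then show ?case using word_rel.relator[of a X "c @ u" r R] by (simp add: words_def)
qed (auto intro: word_rel.intros simp: words_def)

lemma word_rel_append_left:
  "(v, w) \<in> word_rel X R \<Longrightarrow> u \<in> words X \<Longrightarrow> (u @ v, u @ w) \<in> word_rel X R"
proof (induction rule: word_rel.induct)
  case (cancel a c x b)
  then show ?case using word_rel.cancel[of "u @ a" X c x b R] by (simp add: words_def)
next
  case (relator a c r)
  then show ?case using word_rel.relator[of "u @ a" X c r R] by (simp add: words_def)
qed (auto intro: word_rel.intros simp: words_def)

lemma presented_group_mult:
  assumes "v \<in> words X" "w \<in> words X"
  shows "(word_rel X R `` {v}) \<otimes>\<^bsub>presented_group X R\<^esub> (word_rel X R `` {w}) = word_rel X R `` {v @ w}"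
proof -
  have "congruent2 (word_rel X R) (word_rel X R) (\<lambda>p q. word_rel X R `` {p @ q})"
  proof (rule congruent2I')
    fix a b c d assume "(a, b) \<in> word_rel X R" "(c, d) \<in> word_rel X R"
    then have "(a @ c, b @ d) \<in> word_rel X R"
      by (meson word_rel.trans word_rel_append_left word_rel_append_right word_rel_words)
    then show "word_rel X R `` {a @ c} = word_rel X R `` {b @ d}"
      by (rule equiv_class_eq[OF equiv_word_rel])
  qed
  then show ?thesis
    using UN_equiv_class2[OF equiv_word_rel equiv_word_rel _ assms] by (simp add: presented_group_def)
qed

lemma word_rel_inverse:
  "w \<in> words X \<Longrightarrow> (rev (map (\<lambda>(x, b). (x, \<not> b)) w) @ w, []) \<in> word_rel X R"
proof (induction w)
  case (Cons l w)
  obtain x b where l: "l = (x, b)" by force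
  let ?i = "rev (map (\<lambda>(x, b). (x, \<not> b)) w)"
  from Cons.prems have w: "w \<in> words X" and x: "x \<in> X" by (auto simp: words_def l)
  then have "?i \<in> words X" by (auto simp: words_def in_lists_conv_set)
  with w x have "(?i @ [(x, \<not> b), (x, \<not> \<not> b)] @ w, ?i @ w) \<in> word_rel X R"
    by (intro word_rel.cancel)
  from word_rel.trans[OF this Cons.IH[OF w]] show ?case by (simp add: l)
qed (auto intro: word_rel.refl simp: words_def)

lemma group_presented_group: "group (presented_group X R)"
proof (rule groupI)
  let ?P = "presented_group X R" and ?c = "\<lambda>w. word_rel X R `` {w}"
  have cE: "\<exists>w\<in>words X. p = ?c w" if "p \<in> carrier ?P" for p
    using that by (auto simp: presented_group_def elim: quotientE)
  have cI: "?c w \<in> carrier ?P" if "w \<in> words X" for w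
    using that by (simp add: presented_group_def quotientI)
  have one: "\<one>\<^bsub>?P\<^esub> = ?c []" by (simp add: presented_group_def)
  have app: "v @ w \<in> words X" if "v \<in> words X" "w \<in> words X" for v w :: "'a word"
    using that by (simp add: words_def)
  have nil: "[] \<in> words X" by (simp add: words_def)
  show "\<one>\<^bsub>?P\<^esub> \<in> carrier ?P" by (simp add: one cI nil)
  fix p assume "p \<in> carrier ?P"
  then obtain u where u: "u \<in> words X" and p: "p = ?c u" using cE by blast
  show "\<one>\<^bsub>?P\<^esub> \<otimes>\<^bsub>?P\<^esub> p = p" by (simp add: one p presented_group_mult nil u)
  show "\<exists>q\<in>carrier ?P. q \<otimes>\<^bsub>?P\<^esub> p = \<one>\<^bsub>?P\<^esub>"
  proof
    let ?i = "rev (map (\<lambda>(x, b). (x, \<not> b)) u)"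
    have i: "?i \<in> words X" using u by (auto simp: words_def in_lists_conv_set)
    show "?c ?i \<in> carrier ?P" by (rule cI[OF i])
    show "?c ?i \<otimes>\<^bsub>?P\<^esub> p = \<one>\<^bsub>?P\<^esub>"
      unfolding p one presented_group_mult[OF i u]
      by (rule equiv_class_eq[OF equiv_word_rel word_rel_inverse[OF u]])
  qed
  fix q assume "q \<in> carrier ?P"
  then obtain v where v: "v \<in> words X" and q: "q = ?c v" using cE by blast
  show "p \<otimes>\<^bsub>?P\<^esub> q \<in> carrier ?P" by (simp add: p q presented_group_mult u v cI app)
  fix r assume "r \<in> carrier ?P"
  then obtain w where w: "w \<in> words X" and r: "r = ?c w" using cE by blast
  show "p \<otimes>\<^bsub>?P\<^esub> q \<otimes>\<^bsub>?P\<^esub> r = p \<otimes>\<^bsub>?P\<^esub> (q \<otimes>\<^bsub>?P\<^esub> r)"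
    by (simp add: p q r presented_group_mult u v w app)
qed

definition generator_class :: "'x set \<Rightarrow> 'x word set \<Rightarrow> 'x \<Rightarrow> 'x word set" where
  "generator_class X R x = word_rel X R `` {[pos x]}"


section \<open>Free groups\<close>

abbreviation free_group :: "'x set \<Rightarrow> 'x word set monoid" where
  "free_group X \<equiv> presented_group X {}"

text \<open>Since a free basis embeds, it may be taken inside the group.\<close>

definition is_free_group :: "('a, 'b) monoid_scheme \<Rightarrow> bool" where
  "is_free_group F \<longleftrightarrow>
     (\<exists>X \<subseteq> carrier F. \<exists>\<psi> \<in> iso (free_group X) F. \<forall>x\<in>X. \<psi> (generator_class X {} x) = x)"

definition contains_nonabelian_free_subgroup :: "('a, 'b) monoid_scheme \<Rightarrow> bool" where
  "contains_nonabelian_free_subgroup G \<longleftrightarrow>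
     (\<exists>F. subgroup F G \<and> is_free_group (G\<lparr>carrier := F\<rparr>) \<and> \<not> comm_group (G\<lparr>carrier := F\<rparr>))"


section \<open>HNN extensions\<close>

datatype 'a hnn_gen = Vertex 'a | Stable

definition hnn_gens :: "('a, 'b) monoid_scheme \<Rightarrow> 'a hnn_gen set" where
  "hnn_gens A = insert Stable (Vertex ` carrier A)"

text \<open>The first set of relators is the multiplication table of \<open>A\<close>; the second one encodes
  \<open>t\<^sup>-\<^sup>1 c t = \<iota>(c)\<close>.\<close>

definition hnn_relators ::
    "('a, 'b) monoid_scheme \<Rightarrow> 'a set \<Rightarrow> ('a \<Rightarrow> 'a) \<Rightarrow> 'a hnn_gen word set" where
  "hnn_relators A C \<iota> =
     {[pos (Vertex a), pos (Vertex b), neg (Vertex (a \<otimes>\<^bsub>A\<^esub> b))] | a b.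
        a \<in> carrier A \<and> b \<in> carrier A} \<union>
     {[neg Stable, pos (Vertex c), pos Stable, neg (Vertex (\<iota> c))] | c. c \<in> C}"

definition hnn_extension ::
    "('a, 'b) monoid_scheme \<Rightarrow> 'a set \<Rightarrow> ('a \<Rightarrow> 'a) \<Rightarrow> 'a hnn_gen word set monoid" where
  "hnn_extension A C \<iota> = presented_group (hnn_gens A) (hnn_relators A C \<iota>)"

definition hnn_class ::
    "('a, 'b) monoid_scheme \<Rightarrow> 'a set \<Rightarrow> ('a \<Rightarrow> 'a) \<Rightarrow> 'a hnn_gen \<Rightarrow> 'a hnn_gen word set" where
  "hnn_class A C \<iota> = generator_class (hnn_gens A) (hnn_relators A C \<iota>)"

text \<open>A splitting of \<open>H\<close> as an HNN extension. As the vertex group of an HNN extension embeds in it,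
  the vertex group is taken to be a subgroup \<open>A\<close> of \<open>H\<close>, and the stable letter an element \<open>t\<close>
  of \<open>H\<close>.\<close>

definition splits_as_hnn ::
    "('a, 'b) monoid_scheme \<Rightarrow> 'a set \<Rightarrow> 'a set \<Rightarrow> ('a \<Rightarrow> 'a) \<Rightarrow> 'a \<Rightarrow> bool" where
  "splits_as_hnn H A C \<iota> t \<longleftrightarrow>
     subgroup A H \<and> subgroup C (H\<lparr>carrier := A\<rparr>) \<and>
     \<iota> \<in> mon (H\<lparr>carrier := C\<rparr>) (H\<lparr>carrier := A\<rparr>) \<and> t \<in> carrier H \<and>
     (\<exists>\<psi> \<in> iso (hnn_extension (H\<lparr>carrier := A\<rparr>) C \<iota>) H.
        (\<forall>a\<in>A. \<psi> (hnn_class (H\<lparr>carrier := A\<rparr>) C \<iota> (Vertex a)) = a) \<and>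
        \<psi> (hnn_class (H\<lparr>carrier := A\<rparr>) C \<iota> Stable) = t)"

definition normal_closure :: "('a, 'b) monoid_scheme \<Rightarrow> 'a set \<Rightarrow> 'a set" where
  "normal_closure H A = \<Inter>{N. N \<lhd> H \<and> A \<subseteq> N}"

text \<open>The map \<open>\<theta>\<close> is the identification with the integers of the quotient of \<open>H\<close> by the normal
  closure of the vertex group \<open>A\<close>; it sends the image of the stable letter \<open>t\<close> to \<open>1\<close> or \<open>-1\<close>.\<close>

definition realises ::
    "('a, 'b) monoid_scheme \<Rightarrow> 'a set \<Rightarrow> 'a \<Rightarrow> ('a \<Rightarrow> int) \<Rightarrow> bool" where
  "realises H A t \<phi> \<longleftrightarrow>
     (\<exists>\<theta> \<in> iso (H Mod normal_closure H A) integer_group.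
        (\<theta> (normal_closure H A #>\<^bsub>H\<^esub> t) = 1 \<or> \<theta> (normal_closure H A #>\<^bsub>H\<^esub> t) = - 1) \<and>
        (\<forall>h\<in>carrier H. \<phi> h = \<theta> (normal_closure H A #>\<^bsub>H\<^esub> h)))"


section \<open>Indicable coherence\<close>

definition finitely_generated :: "('a, 'b) monoid_scheme \<Rightarrow> bool" where
  "finitely_generated G \<longleftrightarrow> (\<exists>S. finite S \<and> S \<subseteq> carrier G \<and> generate G S = carrier G)"

definition indicably_coherent :: "('a, 'b) monoid_scheme \<Rightarrow> bool" where
  "indicably_coherent G \<longleftrightarrow>
     (\<forall>H \<phi>. subgroup H G \<and> finitely_generated (G\<lparr>carrier := H\<rparr>) \<and>
            \<phi> \<in> epi (G\<lparr>carrier := H\<rparr>) integer_group \<longrightarrow>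
        (\<exists>A C \<iota> t. splits_as_hnn (G\<lparr>carrier := H\<rparr>) A C \<iota> t \<and>
                   finitely_generated (G\<lparr>carrier := A\<rparr>) \<and>
                   realises (G\<lparr>carrier := H\<rparr>) A t \<phi>))"

end

theory Submission
  imports Defs "HOL-Algebra.Group_Action"
begin

text \<open>Lift a finitely generated subgroup \<open>K\<close> of \<open>G/N\<close> with an epimorphism to the integers to a finitely
  generated \<open>H \<le> G\<close>, which splits as an HNN extension with vertex group \<open>A\<close> and associated subgroups
  \<open>C\<close>, \<open>\<iota> C\<close>. If both were proper, some \<open>a \<in> A\<close> would lie in neither, and \<open>t\<close>, \<open>a t a\<^sup>-\<^sup>1\<close> would generate
  a free group. So, replacing \<open>t\<close> by its inverse if necessary, \<open>t\<^sup>-\<^sup>1 A t \<le> A\<close>; this property passes to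
  \<open>K\<close>, where every element is of the form \<open>t\<^sup>n a t\<^sup>-\<^sup>m\<close>. The same form in the abstract ascending HNN
  extension over the image of \<open>A\<close>, together with the map to the integers, shows that \<open>K\<close> is that
  extension.

  Britton's lemma is avoided: it suffices to let the HNN extension act on some set on which the two
  elements play ping-pong, and the permutation by which \<open>t\<close> acts can be chosen almost arbitrarily.\<close>

section \<open>Evaluating words in a group\<close>

definition letter_eval :: "('g, 'm) monoid_scheme \<Rightarrow> ('x \<Rightarrow> 'g) \<Rightarrow> 'x \<times> bool \<Rightarrow> 'g" where
  "letter_eval M f l = (if snd l then f (fst l) else inv\<^bsub>M\<^esub> f (fst l))"

primrec word_eval :: "('g, 'm) monoid_scheme \<Rightarrow> ('x \<Rightarrow> 'g) \<Rightarrow> 'x word \<Rightarrow> 'g" where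
  "word_eval M f [] = \<one>\<^bsub>M\<^esub>"
| "word_eval M f (l # w) = letter_eval M f l \<otimes>\<^bsub>M\<^esub> word_eval M f w"

lemma words_Nil [simp]: "[] \<in> words X"
  and words_Cons [simp]: "l # w \<in> words X \<longleftrightarrow> fst l \<in> X \<and> w \<in> words X"
  and words_append [simp]: "v @ w \<in> words X \<longleftrightarrow> v \<in> words X \<and> w \<in> words X"
  by (auto simp: words_def mem_Times_iff)

context group
begin

lemma mult_inv_cancel [simp]:
  assumes "x \<in> carrier G" "y \<in> carrier G"
  shows "x \<otimes> (inv x \<otimes> y) = y" "inv x \<otimes> (x \<otimes> y) = y"
  using assms by (simp_all add: m_assoc[symmetric])

lemma letter_eval_closed [simp]:
  "f \<in> X \<rightarrow> carrier G \<Longrightarrow> fst l \<in> X \<Longrightarrow> letter_eval G f l \<in> carrier G"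
  by (auto simp: letter_eval_def)

lemma word_eval_closed [simp]:
  "f \<in> X \<rightarrow> carrier G \<Longrightarrow> w \<in> words X \<Longrightarrow> word_eval G f w \<in> carrier G"
  by (induction w) auto

lemma word_eval_append:
  assumes "f \<in> X \<rightarrow> carrier G" "v \<in> words X" "w \<in> words X"
  shows "word_eval G f (v @ w) = word_eval G f v \<otimes> word_eval G f w"
  using assms(2)
proof (induction v)
  case (Cons l v)
  with assms show ?case
    by (simp add: m_assoc letter_eval_closed[OF assms(1)] word_eval_closed[OF assms(1)])
qed (use assms in simp)

lemma word_eval_in_generate:
  assumes "f \<in> X \<rightarrow> carrier G" "w \<in> words X"
  shows "word_eval G f w \<in> generate G (f ` X)"
  using assms(2)
proof (induction w)
  case (Cons l w)
  then have "letter_eval G f l \<in> generate G (f ` X)"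
    by (auto simp: letter_eval_def intro: generate.incl generate.inv)
  with Cons show ?case by (auto intro: generate.eng)
qed (auto intro: generate.one)

text \<open>This lets evaluation descend to the presented group. A pair of inverse letters and a
  relator both evaluate to the identity, and \<open>word_eval_append\<close> removes them from the
  middle of a word.\<close>

lemma word_eval_cong_word_rel:
  assumes f: "f \<in> X \<rightarrow> carrier G"
    and R: "\<And>r. r \<in> R \<Longrightarrow> r \<in> words X \<Longrightarrow> word_eval G f r = \<one>"
    and "(v, w) \<in> word_rel X R"
  shows "word_eval G f v = word_eval G f w"
  using assms(3)
proof (induction rule: word_rel.induct)
  case (cancel u v x b)
  have "f x \<in> carrier G" using f cancel by auto
  then have "word_eval G f [(x, b), (x, \<not> b)] = \<one>" by (simp add: letter_eval_def)
  moreover have "[(x, b), (x, \<not> b)] \<in> words X" using cancel by simp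
  ultimately show ?case
    using cancel f by (simp only: word_eval_append[OF f] words_append word_eval_closed[OF f] l_one)
next
  case (relator u v r)
  then show ?case
    using R f by (simp add: word_eval_append[OF f] word_eval_closed[OF f])
qed auto

end

section \<open>Homomorphisms from presented groups\<close>

lemma presented_class_closed [simp]:
  "w \<in> words X \<Longrightarrow> word_rel X R `` {w} \<in> carrier (presented_group X R)"
  by (simp add: presented_group_def quotientI)

lemma presented_carrierE:
  assumes "p \<in> carrier (presented_group X R)"
  obtains w where "w \<in> words X" "p = word_rel X R `` {w}"
  using assms by (auto simp: presented_group_def elim: quotientE)

lemma presented_one: "\<one>\<^bsub>presented_group X R\<^esub> = word_rel X R `` {[]}"
  by (simp add: presented_group_def)

lemma generator_class_closed: "generator_class X R \<in> X \<rightarrow> carrier (presented_group X R)"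
  by (simp add: generator_class_def)

text \<open>A formal inverse letter represents the actual inverse of its generator, so evaluation in
  the presented group reproduces a word letter by letter. Identities between values can then be read
  off from \<open>word_rel\<close>.\<close>

lemma word_eval_generator_class:
  assumes "w \<in> words X"
  shows "word_eval (presented_group X R) (generator_class X R) w = word_rel X R `` {w}"
  using assms
proof (induction w)
  case Nil
  then show ?case by (simp add: presented_one)
next
  case (Cons l w)
  interpret P: group "presented_group X R" by (rule group_presented_group)
  obtain x b where l: "l = (x, b)" by force
  have x: "x \<in> X" using Cons l by simp
  have "(word_rel X R `` {[neg x]}) \<otimes>\<^bsub>presented_group X R\<^esub> generator_class X R x = \<one>\<^bsub>presented_group X R\<^esub>"
    using x word_rel.cancel[of "[]" X "[]" x False R]
    by (simp add: generator_class_def presented_group_mult presented_one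
        equiv_class_eq[OF equiv_word_rel])
  then have "inv\<^bsub>presented_group X R\<^esub> generator_class X R x = word_rel X R `` {[neg x]}"
    using x by (intro P.inv_equality) (auto simp: generator_class_def)
  then have "letter_eval (presented_group X R) (generator_class X R) l = word_rel X R `` {[l]}"
    by (simp add: l letter_eval_def generator_class_def)
  with Cons show ?case by (simp add: presented_group_mult)
qed

lemma word_eval_generator_class_relator:
  assumes "r \<in> R" "r \<in> words X"
  shows "word_eval (presented_group X R) (generator_class X R) r = \<one>\<^bsub>presented_group X R\<^esub>"
  using word_rel.relator[of "[]" X "[]" r R] assms
  by (simp add: word_eval_generator_class presented_one equiv_class_eq[OF equiv_word_rel])

lemma generate_generator_class:
  "generate (presented_group X R) (generator_class X R ` X) = carrier (presented_group X R)"
proof -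
  interpret P: group "presented_group X R" by (rule group_presented_group)
  note gc = generator_class_closed[of X R]
  show ?thesis
  proof
    show "generate (presented_group X R) (generator_class X R ` X) \<subseteq> carrier (presented_group X R)"
      using gc by (intro P.generate_incl) auto
    show "carrier (presented_group X R) \<subseteq> generate (presented_group X R) (generator_class X R ` X)"
      using P.word_eval_in_generate[OF gc]
      by (auto elim!: presented_carrierE simp: word_eval_generator_class)
  qed
qed

text \<open>The value is well defined only if the relators evaluate to the identity.\<close>

definition presented_hom ::
    "('g, 'm) monoid_scheme \<Rightarrow> ('x \<Rightarrow> 'g) \<Rightarrow> 'x word set \<Rightarrow> 'g" where
  "presented_hom M f p = the_elem (word_eval M f ` p)"

context group
begin

lemma presented_hom_class:
  assumes "f \<in> X \<rightarrow> carrier G"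
    and "\<And>r. r \<in> R \<Longrightarrow> r \<in> words X \<Longrightarrow> word_eval G f r = \<one>"
    and w: "w \<in> words X"
  shows "presented_hom G f (word_rel X R `` {w}) = word_eval G f w"
proof -
  have "word_eval G f ` (word_rel X R `` {w}) = {word_eval G f w}"
    using word_eval_cong_word_rel[OF assms(1,2)] word_rel.refl[OF w] by fastforce
  then show ?thesis by (simp add: presented_hom_def)
qed

lemma presented_hom_in_hom:
  assumes "f \<in> X \<rightarrow> carrier G"
    and "\<And>r. r \<in> R \<Longrightarrow> r \<in> words X \<Longrightarrow> word_eval G f r = \<one>"
  shows "presented_hom G f \<in> hom (presented_group X R) G"
proof (rule homI)
  fix p assume "p \<in> carrier (presented_group X R)"
  then obtain v where v: "v \<in> words X" "p = word_rel X R `` {v}" by (rule presented_carrierE)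
  then show "presented_hom G f p \<in> carrier G"
    using presented_hom_class[OF assms] assms(1) by simp
  fix q assume "q \<in> carrier (presented_group X R)"
  then obtain w where "w \<in> words X" "q = word_rel X R `` {w}" by (rule presented_carrierE)
  with v show "presented_hom G f (p \<otimes>\<^bsub>presented_group X R\<^esub> q)
      = presented_hom G f p \<otimes> presented_hom G f q"
    using presented_hom_class[OF assms] word_eval_append[OF assms(1)]
    by (simp add: presented_group_mult)
qed

lemma presented_hom_generator:
  assumes "f \<in> X \<rightarrow> carrier G"
    and "\<And>r. r \<in> R \<Longrightarrow> r \<in> words X \<Longrightarrow> word_eval G f r = \<one>"
    and "x \<in> X"
  shows "presented_hom G f (generator_class X R x) = f x"
  using presented_hom_class[OF assms(1,2), of R "[pos x]"] assms(1,3)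
  by (auto simp: generator_class_def letter_eval_def Pi_def)

end

section \<open>Ping-pong\<close>

text \<open>By \<open>red\<close>, a nonempty word of value one contains a pair of inverse letters.
  Deleting the pair keeps the value and shortens the word, so induction on the length
  applies.\<close>

lemma word_rel_Nil_of_eval_one:
  assumes M: "group M" and f: "f \<in> X \<rightarrow> carrier M"
    and red: "\<And>w. w \<in> words X \<Longrightarrow> w \<noteq> [] \<Longrightarrow>
      (\<forall>u v x b. w \<noteq> u @ [(x, b), (x, \<not> b)] @ v) \<Longrightarrow> word_eval M f w \<noteq> \<one>\<^bsub>M\<^esub>"
    and "w \<in> words X" "word_eval M f w = \<one>\<^bsub>M\<^esub>"
  shows "(w, []) \<in> word_rel X {}"
  using assms(4,5)
proof (induction w rule: length_induct)
  case (1 w)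
  show ?case
  proof (cases "w = []")
    case True
    then show ?thesis by (simp add: word_rel.refl)
  next
    case False
    then obtain u v x b where w: "w = u @ [(x, b), (x, \<not> b)] @ v" using red 1 by blast
    have "u \<in> words X" "v \<in> words X" "x \<in> X" using 1 w by simp_all
    then have step: "(w, u @ v) \<in> word_rel X {}" unfolding w by (rule word_rel.cancel)
    have "word_eval M f (u @ v) = \<one>\<^bsub>M\<^esub>"
      using group.word_eval_cong_word_rel[OF M f _ step] 1 by simp
    moreover have "u @ v \<in> words X" "length (u @ v) < length w" using 1 w by simp_all
    ultimately have "(u @ v, []) \<in> word_rel X {}" using 1 by blast
    with step show ?thesis by (rule word_rel.trans)
  qed
qed

text \<open>\<open>red\<close> makes the canonical homomorphism from the free group injective, by
  \<open>word_rel_Nil_of_eval_one\<close>. The basis lies inside the group, so words are evaluated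
  at the identity function.\<close>

lemma is_free_groupI:
  assumes M: "group M" and X: "X \<subseteq> carrier M"
    and red: "\<And>w. w \<in> words X \<Longrightarrow> w \<noteq> [] \<Longrightarrow>
      (\<forall>u v x b. w \<noteq> u @ [(x, b), (x, \<not> b)] @ v) \<Longrightarrow> word_eval M (\<lambda>x. x) w \<noteq> \<one>\<^bsub>M\<^esub>"
  shows "is_free_group (M\<lparr>carrier := generate M X\<rparr>)"
proof -
  interpret M: group M by (rule M)
  interpret P: group "free_group X" by (rule group_presented_group)
  have f: "(\<lambda>x. x) \<in> X \<rightarrow> carrier M" using X by auto
  let ?h = "presented_hom M (\<lambda>x. x)"
  have h: "?h \<in> hom (free_group X) M" using f by (intro M.presented_hom_in_hom) auto
  interpret h: group_hom "free_group X" M ?h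
    by unfold_locales (rule h)
  have gen: "?h (generator_class X {} x) = x" if "x \<in> X" for x
    using M.presented_hom_generator[OF f, of "{}"] that by simp
  have "?h ` carrier (free_group X) = generate M (?h ` generator_class X {} ` X)"
    using h.generate_img[OF image_subset_iff_funcset[THEN iffD2, OF generator_class_closed]]
    by (simp only: generate_generator_class)
  also have "?h ` generator_class X {} ` X = X" using gen by force
  finally have img: "?h ` carrier (free_group X) = generate M X" .
  have "inj_on ?h (carrier (free_group X))"
  proof (rule h.inj_on_one_iff[THEN iffD2], intro allI impI)
    fix p assume p: "p \<in> carrier (free_group X)" "?h p = \<one>\<^bsub>M\<^esub>"
    obtain w where w: "w \<in> words X" "p = word_rel X {} `` {w}"
      using p(1) by (rule presented_carrierE)
    then have "word_eval M (\<lambda>x. x) w = \<one>\<^bsub>M\<^esub>"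
      using M.presented_hom_class[OF f, of "{}" w] p(2) by simp
    with w show "p = \<one>\<^bsub>free_group X\<^esub>"
      using equiv_class_eq[OF equiv_word_rel word_rel_Nil_of_eval_one[OF M f red, of w]]
      by (simp add: presented_one)
  qed
  with img have "bij_betw ?h (carrier (free_group X)) (generate M X)" by (simp add: bij_betw_def)
  then have "?h \<in> iso (free_group X) (M\<lparr>carrier := generate M X\<rparr>)"
    using h img by (auto simp: iso_def hom_def)
  moreover have "X \<subseteq> carrier (M\<lparr>carrier := generate M X\<rparr>)" by (auto intro: generate.incl)
  ultimately show ?thesis using gen unfolding is_free_group_def by blast
qed

text \<open>The set \<open>D (x, b)\<close> attracts the letter \<open>(x, b)\<close>.\<close>

lemma ping_pong:
  assumes "group_action M E \<rho>" and X: "X \<subseteq> carrier M"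
    and maps: "\<And>l s. fst l \<in> X \<Longrightarrow> s \<in> E \<Longrightarrow> s \<notin> D (fst l, \<not> snd l) \<Longrightarrow>
      \<rho> (letter_eval M (\<lambda>x. x) l) s \<in> D l"
    and disj: "\<And>l l' s. fst l \<in> X \<Longrightarrow> fst l' \<in> X \<Longrightarrow> s \<in> D l \<Longrightarrow> s \<in> D l' \<Longrightarrow> l = l'"
    and p: "p \<in> E" "\<And>l. fst l \<in> X \<Longrightarrow> p \<notin> D l"
    and xy: "x \<in> X" "y \<in> X" "x \<noteq> y"
  shows "contains_nonabelian_free_subgroup M"
proof -
  interpret act: group_action M E \<rho> by fact
  have M: "group M" by (rule act.group_hom[THEN group_hom.axioms(1)])
  interpret M: group M by (rule M)
  have f: "(\<lambda>x. x) \<in> X \<rightarrow> carrier M" using X by auto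
  \<comment> \<open>The first letter of a nonempty reduced word acts last and decides where the base
    point \<open>p\<close> ends up.\<close>
  have inD: "\<rho> (word_eval M (\<lambda>x. x) (l # w)) p \<in> D l"
    if "l # w \<in> words X" "\<forall>u v x b. l # w \<noteq> u @ [(x, b), (x, \<not> b)] @ v" for l w
    using that
  proof (induction w arbitrary: l)
    case Nil
    then show ?case using maps[of l p] p M.letter_eval_closed[OF f, of l] by simp
  next
    case (Cons k w)
    have "\<forall>u v x b. k # w \<noteq> u @ [(x, b), (x, \<not> b)] @ v"
    proof (intro allI notI)
      fix u v x b assume "k # w = u @ [(x, b), (x, \<not> b)] @ v"
      then have "l # k # w = (l # u) @ [(x, b), (x, \<not> b)] @ v" by simp
      with Cons.prems(2) show False by blast
    qed
    with Cons have k: "\<rho> (word_eval M (\<lambda>x. x) (k # w)) p \<in> D k" by simp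
    \<comment> \<open>Reducedness keeps \<open>k\<close> from being the inverse of \<open>l\<close>,
      so by \<open>disj\<close> the point in \<open>D k\<close> avoids the one set on which
      \<open>maps\<close> says nothing about \<open>l\<close>.\<close>
    have "k \<noteq> (fst l, \<not> snd l)"
      using Cons.prems(2)[rule_format, of "[]" "fst l" "snd l" w] by (cases l) auto
    with k disj Cons.prems have "\<rho> (word_eval M (\<lambda>x. x) (k # w)) p \<notin> D (fst l, \<not> snd l)"
      by (metis fst_conv words_Cons)
    moreover have "\<rho> (word_eval M (\<lambda>x. x) (k # w)) p \<in> E"
      using Cons.prems p M.word_eval_closed[OF f, of "k # w"] act.element_image by auto
    ultimately have "\<rho> (letter_eval M (\<lambda>x. x) l) (\<rho> (word_eval M (\<lambda>x. x) (k # w)) p) \<in> D l"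
      using maps Cons.prems by simp
    then show ?case
      using act.composition_rule[OF p(1), of "letter_eval M (\<lambda>x. x) l" "word_eval M (\<lambda>x. x) (k # w)"]
        M.word_eval_closed[OF f, of "k # w"] M.letter_eval_closed[OF f, of l] Cons.prems
      by simp
  qed
  have "is_free_group (M\<lparr>carrier := generate M X\<rparr>)"
  proof (rule is_free_groupI[OF M X])
    fix w assume w: "w \<in> words X" "w \<noteq> []" "\<forall>u v x b. w \<noteq> u @ [(x, b), (x, \<not> b)] @ v"
    then obtain l w' where lw: "w = l # w'" by (cases w) auto
    have "\<rho> (word_eval M (\<lambda>x. x) w) p \<in> D l" using inD[of l w'] w unfolding lw by blast
    moreover have "p \<notin> D l" using p(2) w lw by simp
    moreover have "\<rho> \<one>\<^bsub>M\<^esub> p = p" using p(1) by (simp flip: act.id_eq_one)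
    ultimately show "word_eval M (\<lambda>x. x) w \<noteq> \<one>\<^bsub>M\<^esub>" by auto
  qed
  moreover have "\<not> comm_group (M\<lparr>carrier := generate M X\<rparr>)"
  proof
    assume "comm_group (M\<lparr>carrier := generate M X\<rparr>)"
    then interpret F: comm_group "M\<lparr>carrier := generate M X\<rparr>" .
    \<comment> \<open>If \<open>x\<close> and \<open>y\<close> commuted, their product would move
      \<open>p\<close> into both \<open>D (x, True)\<close> and \<open>D (y, True)\<close>, which
      are disjoint.\<close>
    have step: "\<rho> (v \<otimes>\<^bsub>M\<^esub> w) p \<in> D (v, True)" if "v \<in> X" "w \<in> X" "v \<noteq> w" for v w
    proof -
      have nc: "\<forall>u z a b. [(v, True), (w, True)] \<noteq> u @ [(a, b), (a, \<not> b)] @ z"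
      proof (intro allI notI)
        fix u z a b assume eq: "[(v, True), (w, True)] = u @ [(a, b), (a, \<not> b)] @ z"
        from arg_cong[OF eq, of length] have "u = []" by simp
        with eq that(3) show False by simp
      qed
      have "\<rho> (word_eval M (\<lambda>x. x) [(v, True), (w, True)]) p \<in> D (v, True)"
        by (rule inD[OF _ nc]) (use that(1,2) in simp)
      moreover have "v \<in> carrier M" "w \<in> carrier M" using that(1,2) X by blast+
      ultimately show ?thesis by (simp add: letter_eval_def)
    qed
    have "x \<otimes>\<^bsub>M\<^esub> y = y \<otimes>\<^bsub>M\<^esub> x"
      using F.m_comm[of x y] generate.incl[OF xy(1), of M] generate.incl[OF xy(2), of M] by simp
    then have "\<rho> (x \<otimes>\<^bsub>M\<^esub> y) p \<in> D (y, True)"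
      using step[OF xy(2,1)] xy(3) by metis
    with step[OF xy] have "(x, True) = (y, True)"
      by (rule disj[rotated 2]) (simp_all add: xy)
    then show False using xy(3) by simp
  qed
  ultimately show ?thesis
    using M.generate_is_subgroup[OF X] unfolding contains_nonabelian_free_subgroup_def
    by (intro exI[of _ "generate M X"] conjI)
qed

section \<open>Ascending HNN extensions\<close>

context group
begin

text \<open>\<open>generate\<close> closes under arbitrary products, whereas a normal form is
  maintained by multiplying with one letter at a time on the left.\<close>

lemma generate_left_induct [consumes 2, case_names one mult inv_mult]:
  assumes "g \<in> generate G S" and S: "S \<subseteq> carrier G"
    and one: "P \<one>"
    and mult: "\<And>s w. s \<in> S \<Longrightarrow> w \<in> carrier G \<Longrightarrow> P w \<Longrightarrow> P (s \<otimes> w)"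
    and inv_mult: "\<And>s w. s \<in> S \<Longrightarrow> w \<in> carrier G \<Longrightarrow> P w \<Longrightarrow> P (inv s \<otimes> w)"
  shows "P g"
proof -
  \<comment> \<open>For this stronger claim the product rule is immediate: if left multiplication by
    two elements preserves \<open>P\<close>, so does left multiplication by their product.\<close>
  have "\<forall>w\<in>carrier G. P w \<longrightarrow> P (g \<otimes> w)" using assms(1)
  proof induction
    case (eng g h)
    then have "g \<in> carrier G" "h \<in> carrier G" using generate_in_carrier[OF S] by auto
    with eng show ?case by (simp add: m_assoc)
  qed (use mult inv_mult in auto)
  then show ?thesis using one generate_in_carrier[OF S assms(1)] by (metis one_closed r_one)
qed

lemma conj_pow_closed:
  assumes A: "subgroup A G" and t: "t \<in> carrier G"
    and conj: "\<And>a. a \<in> A \<Longrightarrow> inv t \<otimes> a \<otimes> t \<in> A" and a: "a \<in> A"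
  shows "inv (t [^] (n::nat)) \<otimes> a \<otimes> t [^] n \<in> A"
proof (induction n)
  case 0
  then show ?case using a subgroup.mem_carrier[OF A] by simp
next
  case (Suc n)
  from conj[OF Suc] show ?case
    using t subgroup.mem_carrier[OF A a] by (simp add: inv_mult_group m_assoc)
qed

text \<open>Left multiplication by a generator or its inverse keeps the form: \<open>t\<close>
  raises \<open>n\<close>; an element of \<open>A\<close> slides past the power of \<open>t\<close>
  and stays in \<open>A\<close> by \<open>conj_pow_closed\<close>; the inverse of \<open>t\<close>
  lowers \<open>n\<close> or, when \<open>n = 0\<close>, moves past \<open>a\<close> and raises
  \<open>m\<close>.\<close>

lemma ascending_form:
  assumes A: "subgroup A G" and t: "t \<in> carrier G"
    and conj: "\<And>a. a \<in> A \<Longrightarrow> inv t \<otimes> a \<otimes> t \<in> A"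
    and g: "g \<in> generate G (insert t A)"
  shows "\<exists>(n::nat) (m::nat). \<exists>a\<in>A. g = t [^] n \<otimes> a \<otimes> inv (t [^] m)"
proof -
  note Ac = subgroup.mem_carrier[OF A]
  have A_mult: "\<exists>(n::nat) (m::nat). \<exists>a'\<in>A. c \<otimes> (t [^] i \<otimes> a \<otimes> inv (t [^] j)) = t [^] n \<otimes> a' \<otimes> inv (t [^] m)"
    if "a \<in> A" "c \<in> A" for a c and i j :: nat
  proof -
    let ?d = "inv (t [^] i) \<otimes> c \<otimes> t [^] i"
    have d: "?d \<in> A" using conj_pow_closed[OF A t conj] that by blast
    have "c \<otimes> (t [^] i \<otimes> a \<otimes> inv (t [^] j)) = t [^] i \<otimes> (?d \<otimes> a) \<otimes> inv (t [^] j)"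
      using Ac that t by (simp add: m_assoc)
    then show ?thesis using subgroup.m_closed[OF A d that(1)] by blast
  qed
  have "insert t A \<subseteq> carrier G" using t Ac by blast
  with g show ?thesis
  proof (induction rule: generate_left_induct)
    case one
    have "\<one> = t [^] (0::nat) \<otimes> \<one> \<otimes> inv (t [^] (0::nat))" by simp
    then show ?case using subgroup.one_closed[OF A] by blast
  next
    case (mult s w)
    then obtain n m :: nat and a where a: "a \<in> A" and w: "w = t [^] n \<otimes> a \<otimes> inv (t [^] m)" by blast
    show ?case
    proof (cases "s = t")
      case True
      then have "s \<otimes> w = t [^] Suc n \<otimes> a \<otimes> inv (t [^] m)"
        unfolding w True nat_pow_Suc2[OF t] using t Ac[OF a] by (simp add: m_assoc)
      with a show ?thesis by blast
    next
      case False
      then show ?thesis using A_mult[OF a] mult w by auto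
    qed
  next
    case (inv_mult s w)
    then obtain n m :: nat and a where a: "a \<in> A" and w: "w = t [^] n \<otimes> a \<otimes> inv (t [^] m)" by blast
    show ?case
    proof (cases "s = t")
      case True
      show ?thesis
      proof (cases n)
        case 0
        have "inv s \<otimes> w = t [^] (0::nat) \<otimes> (inv t \<otimes> a \<otimes> t) \<otimes> inv (t [^] Suc m)"
          using w t Ac a True 0 by (simp add: m_assoc inv_mult_group)
        then show ?thesis using conj[OF a] by blast
      next
        case (Suc k)
        have "inv s \<otimes> w = t [^] k \<otimes> a \<otimes> inv (t [^] m)"
          unfolding w True Suc nat_pow_Suc2[OF t] using t Ac[OF a] by (simp add: m_assoc)
        then show ?thesis using a by blast
      qed
    next
      case False
      then show ?thesis using A_mult[OF a] inv_mult w subgroup.m_inv_closed[OF A] by auto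
    qed
  qed
qed

end

section \<open>Relators and generator classes of an HNN extension\<close>

lemma hnn_relator_eval:
  assumes M: "group M" and f: "f \<in> hnn_gens A \<rightarrow> carrier M"
    and mult: "\<And>a b. a \<in> carrier A \<Longrightarrow> b \<in> carrier A \<Longrightarrow>
      f (Vertex (a \<otimes>\<^bsub>A\<^esub> b)) = f (Vertex a) \<otimes>\<^bsub>M\<^esub> f (Vertex b)"
    and stable: "\<And>c. c \<in> C \<Longrightarrow>
      f (Vertex c) \<otimes>\<^bsub>M\<^esub> f Stable = f Stable \<otimes>\<^bsub>M\<^esub> f (Vertex (\<iota> c))"
    and r: "r \<in> hnn_relators A C \<iota>" "r \<in> words (hnn_gens A)"
  shows "word_eval M f r = \<one>\<^bsub>M\<^esub>"
proof -
  interpret M: group M by (rule M)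
  have fX: "f x \<in> carrier M" if "x \<in> hnn_gens A" for x using f that by auto
  from r(1) show ?thesis unfolding hnn_relators_def
  proof (elim UnE CollectE exE conjE)
    fix a b assume *: "r = [pos (Vertex a), pos (Vertex b), neg (Vertex (a \<otimes>\<^bsub>A\<^esub> b))]"
      "a \<in> carrier A" "b \<in> carrier A"
    have "f (Vertex a) \<in> carrier M" "f (Vertex b) \<in> carrier M"
      using fX *(2,3) by (auto simp: hnn_gens_def)
    then show ?thesis using mult[OF *(2,3)] *(1)
      by (simp add: letter_eval_def M.m_assoc[symmetric])
  next
    fix c assume *: "r = [neg Stable, pos (Vertex c), pos Stable, neg (Vertex (\<iota> c))]" "c \<in> C"
    \<comment> \<open>Both \<open>c\<close> and \<open>\<iota> c\<close> are vertex generators here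
      because \<open>r\<close> is a word over \<open>hnn_gens A\<close>.\<close>
    have "f (Vertex c) \<in> carrier M" "f Stable \<in> carrier M" "f (Vertex (\<iota> c)) \<in> carrier M"
      using fX r(2) *(1) by auto
    then show ?thesis using stable[OF *(2)] *(1)
      by (simp add: letter_eval_def M.m_assoc[symmetric] del: M.mult_inv_cancel)
  qed
qed

lemma hnn_class_closed: "hnn_class A C \<iota> \<in> hnn_gens A \<rightarrow> carrier (hnn_extension A C \<iota>)"
  unfolding hnn_class_def hnn_extension_def by (rule generator_class_closed)

lemma group_hnn_extension: "group (hnn_extension A C \<iota>)"
  unfolding hnn_extension_def by (rule group_presented_group)

lemma generate_hnn_class:
  "generate (hnn_extension A C \<iota>)
     (insert (hnn_class A C \<iota> Stable) ((\<lambda>a. hnn_class A C \<iota> (Vertex a)) ` carrier A))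
   = carrier (hnn_extension A C \<iota>)"
  using generate_generator_class[of "hnn_gens A" "hnn_relators A C \<iota>"]
  unfolding hnn_class_def hnn_extension_def by (simp add: hnn_gens_def image_image)

lemma hnn_class_Vertex_hom:
  assumes "group A"
  shows "(\<lambda>a. hnn_class A C \<iota> (Vertex a)) \<in> hom A (hnn_extension A C \<iota>)"
proof (rule homI)
  interpret A: group A by fact
  let ?P = "hnn_extension A C \<iota>" and ?q = "\<lambda>a. hnn_class A C \<iota> (Vertex a)"
  interpret P: group ?P by (rule group_hnn_extension)
  show q: "?q a \<in> carrier ?P" if "a \<in> carrier A" for a
    using hnn_class_closed[of A C \<iota>] that by (auto simp: hnn_gens_def)
  fix a b assume ab: "a \<in> carrier A" "b \<in> carrier A"
  have "[pos (Vertex a), pos (Vertex b), neg (Vertex (a \<otimes>\<^bsub>A\<^esub> b))] \<in> hnn_relators A C \<iota>"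
    using ab by (auto simp: hnn_relators_def)
  from word_eval_generator_class_relator[OF this, of "hnn_gens A"]
  have "?q a \<otimes>\<^bsub>?P\<^esub> (?q b \<otimes>\<^bsub>?P\<^esub> (inv\<^bsub>?P\<^esub> ?q (a \<otimes>\<^bsub>A\<^esub> b))) = \<one>\<^bsub>?P\<^esub>"
    using ab q[of "a \<otimes>\<^bsub>A\<^esub> b"] unfolding hnn_class_def[symmetric] hnn_extension_def[symmetric]
    by (simp add: letter_eval_def hnn_gens_def)
  then have "(?q a \<otimes>\<^bsub>?P\<^esub> ?q b) \<otimes>\<^bsub>?P\<^esub> inv\<^bsub>?P\<^esub> ?q (a \<otimes>\<^bsub>A\<^esub> b) = \<one>\<^bsub>?P\<^esub>"
    using ab q by (simp add: P.m_assoc)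
  then show "?q (a \<otimes>\<^bsub>A\<^esub> b) = ?q a \<otimes>\<^bsub>?P\<^esub> ?q b"
    using P.inv_solve_right'[of "\<one>\<^bsub>?P\<^esub>" "?q a \<otimes>\<^bsub>?P\<^esub> ?q b" "?q (a \<otimes>\<^bsub>A\<^esub> b)"] ab q by simp
qed

text \<open>The second family of relators, freed of inverses; the hypothesis \<open>stable\<close>
  of \<open>hnn_relator_eval\<close> has the same form.\<close>

lemma hnn_class_Stable_conj:
  assumes "c \<in> C" "c \<in> carrier A" "\<iota> c \<in> carrier A"
  shows "hnn_class A C \<iota> (Vertex c) \<otimes>\<^bsub>hnn_extension A C \<iota>\<^esub> hnn_class A C \<iota> Stable
    = hnn_class A C \<iota> Stable \<otimes>\<^bsub>hnn_extension A C \<iota>\<^esub> hnn_class A C \<iota> (Vertex (\<iota> c))"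
proof -
  let ?P = "hnn_extension A C \<iota>" and ?q = "hnn_class A C \<iota>"
  interpret P: group ?P by (rule group_hnn_extension)
  have q: "?q (Vertex c) \<in> carrier ?P" "?q Stable \<in> carrier ?P" "?q (Vertex (\<iota> c)) \<in> carrier ?P"
    using hnn_class_closed[of A C \<iota>] assms by (auto simp: hnn_gens_def)
  have "[neg Stable, pos (Vertex c), pos Stable, neg (Vertex (\<iota> c))] \<in> hnn_relators A C \<iota>"
    using assms by (auto simp: hnn_relators_def)
  from word_eval_generator_class_relator[OF this, of "hnn_gens A"]
  have "inv\<^bsub>?P\<^esub> ?q Stable \<otimes>\<^bsub>?P\<^esub> (?q (Vertex c) \<otimes>\<^bsub>?P\<^esub> (?q Stable \<otimes>\<^bsub>?P\<^esub> inv\<^bsub>?P\<^esub> ?q (Vertex (\<iota> c)))) = \<one>\<^bsub>?P\<^esub>"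
    using assms q unfolding hnn_class_def[symmetric] hnn_extension_def[symmetric]
    by (simp add: letter_eval_def hnn_gens_def)
  then have "inv\<^bsub>?P\<^esub> ?q Stable \<otimes>\<^bsub>?P\<^esub> (?q (Vertex c) \<otimes>\<^bsub>?P\<^esub> ?q Stable) \<otimes>\<^bsub>?P\<^esub> inv\<^bsub>?P\<^esub> ?q (Vertex (\<iota> c)) = \<one>\<^bsub>?P\<^esub>"
    using q by (simp add: P.m_assoc)
  then have "inv\<^bsub>?P\<^esub> ?q Stable \<otimes>\<^bsub>?P\<^esub> (?q (Vertex c) \<otimes>\<^bsub>?P\<^esub> ?q Stable) = ?q (Vertex (\<iota> c))"
    using q P.inv_solve_right'[of "\<one>\<^bsub>?P\<^esub>" _ "?q (Vertex (\<iota> c))"] by simp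
  then show ?thesis
    using q P.mult_inv_cancel(1)[of "?q Stable" "?q (Vertex c) \<otimes>\<^bsub>?P\<^esub> ?q Stable"] by simp
qed

section \<open>Ascending data with a homomorphism to the integers\<close>

lemma hom_integer_group:
  assumes "group K" "\<phi> \<in> hom K integer_group"
  shows hom_integer_group_mult: "\<And>x y. x \<in> carrier K \<Longrightarrow> y \<in> carrier K \<Longrightarrow> \<phi> (x \<otimes>\<^bsub>K\<^esub> y) = \<phi> x + \<phi> y"
    and hom_integer_group_inv: "\<And>x. x \<in> carrier K \<Longrightarrow> \<phi> (inv\<^bsub>K\<^esub> x) = - \<phi> x"
    and hom_integer_group_pow: "\<And>x. x \<in> carrier K \<Longrightarrow> \<phi> (x [^]\<^bsub>K\<^esub> (n::nat)) = int n * \<phi> x"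
proof -
  interpret h: group_hom K integer_group \<phi>
    using assms by (simp add: group_hom_def group_hom_axioms_def)
  show mult: "\<phi> (x \<otimes>\<^bsub>K\<^esub> y) = \<phi> x + \<phi> y" if "x \<in> carrier K" "y \<in> carrier K" for x y
    using h.hom_mult[OF that] by simp
  show "\<phi> (inv\<^bsub>K\<^esub> x) = - \<phi> x" if "x \<in> carrier K" for x
    using h.hom_inv[OF that] by simp
  show "\<phi> (x [^]\<^bsub>K\<^esub> (n::nat)) = int n * \<phi> x" if "x \<in> carrier K" for x
    using h.hom_one that by (induction n) (simp_all add: mult algebra_simps)
qed

text \<open>The conditions mention no presentation, so they pass to surjective images
  (\<open>ascending_image\<close>), and yet they suffice to recover the presentation
  (\<open>splits\<close>). Both signs of \<open>\<phi> t\<close> are allowed because a stable letter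
  may be exchanged for its inverse.\<close>

locale ascending = group K for K (structure) +
  fixes A t and \<phi> :: "'a \<Rightarrow> int"
  assumes A: "subgroup A K" and t: "t \<in> carrier K"
    and conj: "\<And>a. a \<in> A \<Longrightarrow> inv t \<otimes> a \<otimes> t \<in> A"
    and gen: "generate K (insert t A) = carrier K"
    and \<phi>: "\<phi> \<in> hom K integer_group"
    and \<phi>_A: "\<And>a. a \<in> A \<Longrightarrow> \<phi> a = 0"
    and \<phi>_t: "\<phi> t = 1 \<or> \<phi> t = - 1"
begin

text \<open>As \<open>\<phi> t\<close> is a unit, vanishing of \<open>\<phi>\<close> on such an
  element forces \<open>n = m\<close>.\<close>

lemma \<phi>_form:
  assumes "a \<in> A"
  shows "\<phi> (t [^] (n::nat) \<otimes> a \<otimes> inv (t [^] (m::nat))) = (int n - int m) * \<phi> t"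
  using assms t subgroup.mem_carrier[OF A]
  by (simp add: hom_integer_group[OF is_group \<phi>] \<phi>_A algebra_simps)

text \<open>The canonical map from the abstract extension onto \<open>K\<close> is injective: a
  kernel element has the ascending form already in the extension, \<open>\<phi>\<close> forces equal
  exponents, and what remains is a conjugate of a vertex element that is trivial in
  \<open>K\<close>.\<close>

lemma splits: "splits_as_hnn K A A (\<lambda>a. inv t \<otimes> a \<otimes> t) t"
proof -
  let ?i = "\<lambda>a. inv t \<otimes> a \<otimes> t" and ?A = "K\<lparr>carrier := A\<rparr>"
  let ?P = "hnn_extension ?A A ?i" and ?q = "hnn_class ?A A ?i"
  let ?X = "hnn_gens ?A" and ?R = "hnn_relators ?A A ?i"
  let ?f = "\<lambda>x. case x of Vertex a \<Rightarrow> a | Stable \<Rightarrow> t"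
  note Ac = subgroup.mem_carrier[OF A]
  interpret A': group ?A by (rule subgroup_imp_group[OF A])
  interpret P: group ?P by (rule group_hnn_extension)
  have f: "?f \<in> ?X \<rightarrow> carrier K" using t Ac by (auto simp: hnn_gens_def)
  have rel: "word_eval K ?f r = \<one>" if "r \<in> ?R" "r \<in> words ?X" for r
    by (rule hnn_relator_eval[OF is_group f _ _ that])
      (use t Ac in \<open>simp_all add: m_assoc\<close>)
  let ?h = "presented_hom K ?f"
  interpret h: group_hom ?P K ?h
    using presented_hom_in_hom[OF f rel]
    by unfold_locales (simp add: hnn_extension_def)
  have h_gen: "?h (?q x) = ?f x" if "x \<in> ?X" for x
    unfolding hnn_class_def by (rule presented_hom_generator[OF f rel that])
  have h_Vertex: "?h (?q (Vertex a)) = a" if "a \<in> A" for a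
    using h_gen[of "Vertex a"] that by (simp add: hnn_gens_def)
  have h_Stable: "?h (?q Stable) = t"
    using h_gen[of Stable] by (simp add: hnn_gens_def)
  have q: "?q (Vertex a) \<in> carrier ?P" if "a \<in> A" for a
    using hnn_class_closed[of ?A A ?i] that by (auto simp: hnn_gens_def)
  have T: "?q Stable \<in> carrier ?P"
    using hnn_class_closed[of ?A A ?i] by (auto simp: hnn_gens_def)
  interpret v: group_hom ?A ?P "\<lambda>a. ?q (Vertex a)"
    using hnn_class_Vertex_hom[OF A'.is_group] by unfold_locales
  \<comment> \<open>The image \<open>?B\<close> of the vertex group takes the role of
    \<open>A\<close> when \<open>ascending_form\<close> is applied inside the extension.\<close>
  let ?B = "(\<lambda>a. ?q (Vertex a)) ` A"
  have B: "subgroup ?B ?P" using v.img_is_subgroup by simp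
  have genP: "generate ?P (insert (?q Stable) ?B) = carrier ?P"
    using generate_hnn_class[of ?A A ?i] by simp
  have "insert (?q Stable) ?B \<subseteq> carrier ?P" using q T by blast
  from h.generate_img[OF this]
  have "?h ` carrier ?P = generate K (?h ` insert (?q Stable) ?B)" by (simp only: genP)
  also have "?h ` insert (?q Stable) ?B = insert t A"
    using h_Vertex h_Stable by (simp add: image_image)
  finally have surj: "?h ` carrier ?P = carrier K" using gen by simp
  have "inj_on ?h (carrier ?P)"
  proof (rule h.inj_on_one_iff[THEN iffD2], intro allI impI)
    fix p assume p: "p \<in> carrier ?P" "?h p = \<one>"
    have B_conj: "inv\<^bsub>?P\<^esub> ?q Stable \<otimes>\<^bsub>?P\<^esub> b \<otimes>\<^bsub>?P\<^esub> ?q Stable \<in> ?B" if b: "b \<in> ?B" for b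
    proof -
      obtain a where a: "a \<in> A" "b = ?q (Vertex a)" using b by blast
      have "b \<otimes>\<^bsub>?P\<^esub> ?q Stable = ?q Stable \<otimes>\<^bsub>?P\<^esub> ?q (Vertex (?i a))"
        unfolding a(2) by (rule hnn_class_Stable_conj) (use a conj in simp_all)
      then have "inv\<^bsub>?P\<^esub> ?q Stable \<otimes>\<^bsub>?P\<^esub> b \<otimes>\<^bsub>?P\<^esub> ?q Stable = ?q (Vertex (?i a))"
        using q[OF a(1)] q[OF conj[OF a(1)]] T a(2) by (simp only: P.m_assoc P.inv_closed P.mult_inv_cancel)
      then show ?thesis using conj[OF a(1)] by blast
    qed
    have gen_p: "p \<in> generate ?P (insert (?q Stable) ?B)"
      using p(1) unfolding genP .
    obtain n m :: nat and b where b: "b \<in> ?B"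
      and pf: "p = ?q Stable [^]\<^bsub>?P\<^esub> n \<otimes>\<^bsub>?P\<^esub> b \<otimes>\<^bsub>?P\<^esub> inv\<^bsub>?P\<^esub> (?q Stable [^]\<^bsub>?P\<^esub> m)"
      using P.ascending_form[OF B T B_conj gen_p] by blast
    from b obtain a where a: "a \<in> A" "b = ?q (Vertex a)" by blast
    have "?h p = t [^] n \<otimes> a \<otimes> inv (t [^] m)"
      using a q T h_Vertex h_Stable by (simp add: pf h.hom_nat_pow)
    with p have eq: "t [^] n \<otimes> a \<otimes> inv (t [^] m) = \<one>" by simp
    then have "(int n - int m) * \<phi> t = \<phi> \<one>" using \<phi>_form[OF a(1), of n m] by simp
    also have "\<phi> \<one> = 0" using \<phi>_A subgroup.one_closed[OF A] by blast
    finally have nm: "n = m" using \<phi>_t by auto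
    have "a = inv (t [^] n) \<otimes> (t [^] n \<otimes> a \<otimes> inv (t [^] n)) \<otimes> t [^] n"
      using t Ac[OF a(1)] by (simp add: m_assoc)
    then have "a = \<one>" using eq nm t by simp
    then have "b = \<one>\<^bsub>?P\<^esub>" using a v.hom_one by simp
    then show "p = \<one>\<^bsub>?P\<^esub>" using pf nm T by simp
  qed
  then have "?h \<in> iso ?P K" using surj h.homh by (simp add: iso_def bij_betw_def)
  moreover have "?i \<in> mon ?A ?A"
  proof -
    have "?i \<in> hom ?A ?A"
      using conj t Ac by (auto intro!: homI simp: m_assoc)
    moreover have "inj_on ?i A"
      using t Ac by (intro inj_onI) simp
    ultimately show ?thesis by (simp add: mon_def)
  qed
  moreover have "subgroup A ?A" using A'.subgroup_self by simp
  ultimately show ?thesis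
    unfolding splits_as_hnn_def using A t h_Vertex h_Stable by blast
qed

text \<open>A kernel element has the ascending form with equal exponents, so it is a conjugate of an
  element of \<open>A\<close> and lies in every normal subgroup that contains
  \<open>A\<close>.\<close>

lemma normal_closure_eq: "normal_closure K A = kernel K integer_group \<phi>"
proof
  interpret h: group_hom K integer_group \<phi>
    by (intro group_hom.intro group_hom_axioms.intro is_group group_integer_group \<phi>)
  have "A \<subseteq> kernel K integer_group \<phi>"
    using \<phi>_A subgroup.mem_carrier[OF A] by (auto simp: kernel_def)
  then show "normal_closure K A \<subseteq> kernel K integer_group \<phi>"
    using h.normal_kernel by (auto simp: normal_closure_def)
  show "kernel K integer_group \<phi> \<subseteq> normal_closure K A"
  proof (unfold normal_closure_def, intro Inter_greatest subsetI, elim CollectE conjE)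
    fix N g assume N: "N \<lhd> K" "A \<subseteq> N" and g: "g \<in> kernel K integer_group \<phi>"
    then have "g \<in> generate K (insert t A)" using gen by (simp add: kernel_def)
    then obtain n m :: nat and a where a: "a \<in> A" and gf: "g = t [^] n \<otimes> a \<otimes> inv (t [^] m)"
      using ascending_form[OF A t conj] by blast
    have "(int n - int m) * \<phi> t = 0" using g \<phi>_form[OF a, of n m] gf by (simp add: kernel_def)
    then have "n = m" using \<phi>_t by auto
    then show "g \<in> N" using normal.inv_op_closed2[OF N(1), of "t [^] n" a] N(2) a t gf by auto
  qed
qed

lemma realises: "realises K A t \<phi>"
proof -
  interpret h: group_hom K integer_group \<phi>
    by (intro group_hom.intro group_hom_axioms.intro is_group group_integer_group \<phi>)
  let ?k = "kernel K integer_group \<phi>"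
  have "\<phi> ` carrier K = UNIV"
  proof -
    have "n \<in> \<phi> ` carrier K" for n :: int
    proof -
      \<comment> \<open>Since \<open>\<phi> t\<close> may have either sign, the preimage of
        \<open>n\<close> is a power of \<open>t\<close> or the inverse of one.\<close>
      define k where "k = nat \<bar>n\<bar>"
      have "\<phi> (t [^] k) = int k * \<phi> t" "\<phi> (inv (t [^] k)) = - (int k * \<phi> t)"
        using t by (simp_all add: hom_integer_group[OF is_group \<phi>])
      then have "n = \<phi> (t [^] k) \<or> n = \<phi> (inv (t [^] k))"
        using \<phi>_t by (auto simp: k_def)
      then show ?thesis using t by (metis image_eqI inv_closed nat_pow_closed)
    qed
    then show ?thesis by blast
  qed
  \<comment> \<open>The first isomorphism theorem supplies the identification
    \<open>\<theta>\<close>, which sends a coset of the kernel to the single value of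
    \<open>\<phi>\<close> on it.\<close>
  then have iso: "(\<lambda>X. the_elem (\<phi> ` X)) \<in> iso (K Mod ?k) integer_group"
    using h.FactGroup_iso_set by simp
  have val: "the_elem (\<phi> ` (?k #> g)) = \<phi> g" if g: "g \<in> carrier K" for g
  proof -
    have "\<phi> ` (?k #> g) = {\<phi> g}"
      using g h.subgroup_kernel[THEN subgroup.one_closed] unfolding r_coset_def
      by (auto simp: kernel_def hom_integer_group[OF is_group \<phi>])
    then show ?thesis by simp
  qed
  show ?thesis unfolding realises_def normal_closure_eq
    by (rule bexI[OF _ iso]) (use val t \<phi>_t in auto)
qed

end

section \<open>Non-ascending HNN extensions\<close>

definition coset_rep :: "'a set \<Rightarrow> 'a" where
  "coset_rep K = (SOME g. g \<in> K)"

text \<open>This trivialises \<open>carrier A \<times> I\<close> as a free \<open>C\<close>-set: the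
  first component carries the chosen representative to \<open>g\<close>, and the remaining pair
  names the orbit.\<close>

definition coset_split :: "('a, 'm) monoid_scheme \<Rightarrow> 'a set \<Rightarrow> 'a \<times> 'i \<Rightarrow> 'a \<times> 'a set \<times> 'i" where
  "coset_split A C = (\<lambda>(g, i). (g \<otimes>\<^bsub>A\<^esub> inv\<^bsub>A\<^esub> coset_rep (C #>\<^bsub>A\<^esub> g), C #>\<^bsub>A\<^esub> g, i))"

context group
begin

lemma coset_rep_rcos:
  assumes "subgroup C G" "g \<in> carrier G"
  shows coset_rep_in: "coset_rep (C #> g) \<in> C #> g"
    and coset_rep_closed: "coset_rep (C #> g) \<in> carrier G"
    and rcos_coset_rep: "C #> coset_rep (C #> g) = C #> g"
proof -
  have "g \<in> C #> g" by (rule rcos_self[OF assms(2,1)])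
  then show 1: "coset_rep (C #> g) \<in> C #> g" unfolding coset_rep_def by (rule someI)
  then show "coset_rep (C #> g) \<in> carrier G"
    using assms r_coset_subset_G subgroup.subset by blast
  show "C #> coset_rep (C #> g) = C #> g"
    using repr_independence[OF 1 assms(2,1)] by simp
qed

lemma rcos_mult_left:
  assumes "subgroup C G" "c \<in> C" "g \<in> carrier G"
  shows "C #> (c \<otimes> g) = C #> g"
proof -
  have "c \<otimes> g \<in> C #> g" using assms(2) by (auto simp: r_coset_def)
  then show ?thesis using repr_independence[OF _ assms(3,1)] by simp
qed

lemma rcos_eq_iff_mem:
  assumes "subgroup C G" "g \<in> carrier G"
  shows "C #> g = C \<longleftrightarrow> g \<in> C"
  using coset_join1[OF _ assms(2,1)] coset_join2[OF assms(2,1)] by blast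

text \<open>Left multiplication by \<open>c\<close> fixes the coset of \<open>g\<close> and hence
  its representative, so in these coordinates it changes only the first component.\<close>

lemma coset_split_act:
  assumes "subgroup C G" "c \<in> C" "g \<in> carrier G"
  shows "coset_split G C (c \<otimes> g, i) = apfst (\<lambda>d. c \<otimes> d) (coset_split G C (g, i))"
  using assms coset_rep_closed[OF assms(1,3)] subgroup.mem_carrier[OF assms(1)]
  by (simp add: coset_split_def rcos_mult_left m_assoc)

lemma bij_betw_coset_split:
  assumes C: "subgroup C G"
  shows "bij_betw (coset_split G C) (carrier G \<times> I) (C \<times> (rcosets C) \<times> I)"
proof (rule bij_betw_byWitness[where f' = "\<lambda>(c, K, i). (c \<otimes> coset_rep K, i)"])
  note Cc = subgroup.mem_carrier[OF C]
  show "\<forall>s\<in>carrier G \<times> I. (\<lambda>(c, K, i). (c \<otimes> coset_rep K, i)) (coset_split G C s) = s"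
    using coset_rep_closed[OF C] by (auto simp: coset_split_def m_assoc)
  show "coset_split G C ` (carrier G \<times> I) \<subseteq> C \<times> (rcosets C) \<times> I"
  proof (rule subsetI)
    fix x assume "x \<in> coset_split G C ` (carrier G \<times> I)"
    then obtain g i where g: "g \<in> carrier G" "i \<in> I" and x: "x = coset_split G C (g, i)" by blast
    \<comment> \<open>The representative differs from \<open>g\<close> by some \<open>d\<close> in
      \<open>C\<close>, so the first component is the inverse of \<open>d\<close>.\<close>
    obtain d where "d \<in> C" "coset_rep (C #> g) = d \<otimes> g"
      using coset_rep_in[OF C g(1)] by (auto simp: r_coset_def)
    then have "g \<otimes> inv coset_rep (C #> g) = inv d"
      using g Cc by (simp add: inv_mult_group)
    then show "x \<in> C \<times> (rcosets C) \<times> I"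
      using x g \<open>d \<in> C\<close> subgroup.m_inv_closed[OF C] by (auto simp: coset_split_def RCOSETS_def)
  qed
  have K: "C #> (c \<otimes> coset_rep K) = K" "coset_rep K \<in> carrier G"
    if c: "c \<in> C" and "K \<in> rcosets C" for c K
  proof -
    from that obtain g where g: "g \<in> carrier G" "K = C #> g" by (auto simp: RCOSETS_def)
    show "coset_rep K \<in> carrier G" unfolding g(2) by (rule coset_rep_closed[OF C g(1)])
    then show "C #> (c \<otimes> coset_rep K) = K"
      using rcos_mult_left[OF C c] rcos_coset_rep[OF C g(1)] g(2) by simp
  qed
  show "\<forall>s\<in>C \<times> (rcosets C) \<times> I. coset_split G C ((\<lambda>(c, K, i). (c \<otimes> coset_rep K, i)) s) = s"
  proof (intro ballI, elim SigmaE)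
    fix s c x K i assume "c \<in> C" "K \<in> rcosets C" "x = (K, i)" "s = (c, x)"
    then show "coset_split G C ((\<lambda>(c, K, i). (c \<otimes> coset_rep K, i)) s) = s"
      using K[of c K] Cc[of c] by (simp add: coset_split_def m_assoc)
  qed
  show "(\<lambda>(c, K, i). (c \<otimes> coset_rep K, i)) ` (C \<times> (rcosets C) \<times> I) \<subseteq> carrier G \<times> I"
    using K(2) Cc by (auto intro!: m_closed)
qed

end

section \<open>Bijections of orbit sets adapted to ping-pong\<close>

type_synonym 'k index = "'k list \<times> nat"

text \<open>The two index sets used for the attracting sets of the stable letter and of its inverse are
  disjoint, and the indices with second component \<open>2\<close> modulo \<open>3\<close> lie in neither.\<close>

definition ping_index :: "bool \<Rightarrow> 'k index set" where
  "ping_index b = {i. snd i mod 3 = (if b then 0 else 1)}"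

lemma ping_index_unique: "i \<in> ping_index b \<Longrightarrow> i \<in> ping_index b' \<Longrightarrow> b = b'"
  by (cases b; cases b') (simp_all add: ping_index_def)

text \<open>A list absorbs an element of \<open>'k\<close> by consing it, and multiplication by
  three leaves room for a prescribed residue, so all of \<open>'k \<times> 'k index\<close> injects
  into one piece. With an injection back, Schroeder-Bernstein covers finite and infinite
  \<open>'k\<close> alike.\<close>

lemma bij_betw_into_piece:
  fixes X :: "('k \<times> 'k index) set"
  assumes "\<And>i. i \<in> ping_index b \<Longrightarrow> (D, i) \<in> X"
  shows "\<exists>\<beta>. bij_betw \<beta> X ({C} \<times> (ping_index b :: 'k index set))"
proof -
  let ?e = "\<lambda>(K :: 'k, l, n). (C, K # l, 3 * n + (if b then 0 else 1))" and ?d = "\<lambda>(_, i). (D, i)"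
  have e: "inj_on ?e X" by (rule inj_onI) (auto split: prod.splits)
  have e_img: "?e ` X \<subseteq> {C} \<times> ping_index b"
  proof (rule image_subsetI)
    fix x :: "'k \<times> 'k index"
    obtain K l n where "x = (K, l, n)" using prod_cases3 by blast
    then show "?e x \<in> {C} \<times> ping_index b" by (simp add: ping_index_def)
  qed
  have d: "inj_on ?d ({C} \<times> (ping_index b :: 'k index set))" by (rule inj_onI) auto
  have d_img: "?d ` ({C} \<times> ping_index b) \<subseteq> X" using assms by auto
  show ?thesis by (rule Schroeder_Bernstein[OF e e_img d d_img])
qed

text \<open>Two bijections are glued: the complement of the \<open>D\<close> piece goes onto the
  \<open>C\<close> piece, and the \<open>D\<close> piece onto the complement of the \<open>C\<close>
  piece. The two residue classes are disjoint, so each complement still contains the copy of the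
  indices that \<open>bij_betw_into_piece\<close> demands.\<close>

lemma exists_ping_pong_bij:
  fixes P Q :: "'k set"
  assumes "D \<in> P" "C \<in> Q"
  shows "\<exists>\<beta>. bij_betw \<beta> (P \<times> (UNIV :: 'k index set)) (Q \<times> (UNIV :: 'k index set)) \<and>
    (\<forall>x\<in>P \<times> UNIV. \<beta> x \<in> {C} \<times> ping_index True \<longleftrightarrow> x \<notin> {D} \<times> ping_index False)"
proof -
  let ?P = "P \<times> (UNIV :: 'k index set)" and ?Q = "Q \<times> (UNIV :: 'k index set)"
  let ?D = "{D} \<times> (ping_index False :: 'k index set)" and ?C = "{C} \<times> (ping_index True :: 'k index set)"
  have "(D, i) \<in> ?P - ?D" if "i \<in> ping_index True" for i
    using that assms by (simp add: ping_index_def)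
  then obtain \<beta> where \<beta>: "bij_betw \<beta> (?P - ?D) ?C"
    by (rule bij_betw_into_piece[THEN exE])
  have "(C, i) \<in> ?Q - ?C" if "i \<in> ping_index False" for i
    using that assms by (simp add: ping_index_def)
  then obtain \<gamma> where \<gamma>: "bij_betw \<gamma> (?Q - ?C) ?D"
    by (rule bij_betw_into_piece[THEN exE])
  \<comment> \<open>\<open>bij_betw_into_piece\<close> yields maps onto a piece, so the second
    bijection has to be inverted.\<close>
  let ?\<gamma> = "inv_into (?Q - ?C) \<gamma>"
  have \<gamma>': "bij_betw ?\<gamma> ?D (?Q - ?C)" using \<gamma> by (rule bij_betw_inv_into)
  define f where "f = (\<lambda>x. if x \<in> ?D then ?\<gamma> x else \<beta> x)"
  have 1: "bij_betw f (?P - ?D) ?C"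
    using \<beta> by (subst bij_betw_cong[where g = \<beta>]) (simp_all add: f_def)
  have 2: "bij_betw f ?D (?Q - ?C)"
    using \<gamma>' by (subst bij_betw_cong[where g = ?\<gamma>]) (simp_all add: f_def)
  have "bij_betw f ((?P - ?D) \<union> ?D) (?C \<union> (?Q - ?C))"
    by (rule bij_betw_combine[OF 1 2]) auto
  moreover have "(?P - ?D) \<union> ?D = ?P" "?C \<union> (?Q - ?C) = ?Q" using assms by auto
  ultimately have f: "bij_betw f ?P ?Q" by (simp only:)
  have ping: "f x \<in> ?C \<longleftrightarrow> x \<notin> ?D" if "x \<in> ?P" for x
  proof (cases "x \<in> ?D")
    case True
    then have "f x \<in> ?Q - ?C" by (rule bij_betw_apply[OF 2])
    with True show ?thesis by simp
  next
    case False
    with that have "x \<in> ?P - ?D" by blast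
    then have "f x \<in> ?C" by (rule bij_betw_apply[OF 1])
    with False show ?thesis by simp
  qed
  show ?thesis by (intro exI[of _ f] conjI f ballI ping)
qed

text \<open>Both \<open>C\<close>, acting by left multiplication, and \<open>\<iota> C\<close> act freely on \<open>A \<times> I\<close> with orbit sets
  of the same cardinality once the index set \<open>I\<close> is large; any bijection between the orbit sets
  gives a permutation which can serve as the action of the stable letter.\<close>

lemma (in group) exists_stable_permutation:
  assumes C: "subgroup C G" and \<iota>: "\<iota> \<in> mon (G\<lparr>carrier := C\<rparr>) G"
  defines "E \<equiv> carrier G \<times> (UNIV :: 'a set index set)"
  shows "\<exists>\<tau>. bij_betw \<tau> E E \<and>
    (\<forall>c\<in>C. \<forall>s\<in>E. \<tau> (apfst ((\<otimes>) (\<iota> c)) s) = apfst ((\<otimes>) c) (\<tau> s)) \<and>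
    (\<forall>s\<in>E. \<tau> s \<in> C \<times> ping_index True \<longleftrightarrow> s \<notin> \<iota> ` C \<times> ping_index False)"
proof -
  let ?D = "\<iota> ` C" and ?I = "UNIV :: 'a set index set"
  interpret C: group "G\<lparr>carrier := C\<rparr>" by (rule subgroup_imp_group[OF C])
  have hom: "\<iota> \<in> hom (G\<lparr>carrier := C\<rparr>) G" and inj: "inj_on \<iota> C"
    using \<iota> by (auto simp: mon_def)
  interpret \<iota>: group_hom "G\<lparr>carrier := C\<rparr>" G \<iota>
    using hom by unfold_locales
  have D: "subgroup ?D G" using \<iota>.img_is_subgroup by simp
  have "?D #> \<one> = ?D" "C #> \<one> = C"
    by (rule coset_mult_one[OF subgroup.subset[OF D]], rule coset_mult_one[OF subgroup.subset[OF C]])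
  then have mem: "?D \<in> rcosets ?D" "C \<in> rcosets C"
    using rcosetsI[OF subgroup.subset[OF D] one_closed] rcosetsI[OF subgroup.subset[OF C] one_closed]
    by (simp_all only:)
  obtain \<beta> where \<beta>_all: "bij_betw \<beta> ((rcosets ?D) \<times> ?I) ((rcosets C) \<times> ?I) \<and>
    (\<forall>x\<in>(rcosets ?D) \<times> ?I. \<beta> x \<in> {C} \<times> ping_index True \<longleftrightarrow> x \<notin> {?D} \<times> ping_index False)"
    using exists_ping_pong_bij[OF mem] by (rule exE)
  note \<beta> = conjunct1[OF \<beta>_all] and \<beta>_ping = bspec[OF conjunct2[OF \<beta>_all]]
  let ?\<kappa> = "inv_into C \<iota>"
  have \<kappa>: "bij_betw ?\<kappa> ?D C" using inj by (simp add: bij_betw_inv_into inj_on_imp_bij_betw)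
  have splC: "bij_betw (coset_split G C) E (C \<times> (rcosets C) \<times> ?I)"
    and splD: "bij_betw (coset_split G ?D) E (?D \<times> (rcosets ?D) \<times> ?I)"
    unfolding E_def by (rule bij_betw_coset_split[OF C], rule bij_betw_coset_split[OF D])
  \<comment> \<open>In coset coordinates, taken along \<open>?D\<close> before and along
    \<open>C\<close> after, the permutation undoes \<open>\<iota>\<close> on the subgroup component
    and applies \<open>\<beta>\<close> to the orbits.\<close>
  let ?\<mu> = "map_prod ?\<kappa> \<beta>"
  have \<mu>: "bij_betw ?\<mu> (?D \<times> (rcosets ?D) \<times> ?I) (C \<times> (rcosets C) \<times> ?I)"
    by (rule bij_betw_map_prod[OF \<kappa> \<beta>])
  define \<tau> where "\<tau> = inv_into E (coset_split G C) \<circ> (?\<mu> \<circ> coset_split G ?D)"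
  have \<tau>: "bij_betw \<tau> E E" unfolding \<tau>_def
    by (rule bij_betw_trans[OF bij_betw_trans[OF splD \<mu>] bij_betw_inv_into[OF splC]])
  have split_\<tau>: "coset_split G C (\<tau> s) = ?\<mu> (coset_split G ?D s)" if "s \<in> E" for s
  proof -
    have "?\<mu> (coset_split G ?D s) \<in> C \<times> (rcosets C) \<times> ?I"
      by (rule bij_betw_apply[OF \<mu> bij_betw_apply[OF splD that]])
    from bij_betw_inv_into_right[OF splC this] show ?thesis by (simp only: \<tau>_def comp_apply)
  qed
  \<comment> \<open>Both sides are compared through the injective coordinates along
    \<open>C\<close>, where each becomes
    \<open>(c \<otimes> ?\<kappa> d, \<beta> k)\<close>.\<close>
  have act: "\<tau> (apfst ((\<otimes>) (\<iota> c)) s) = apfst ((\<otimes>) c) (\<tau> s)" if c: "c \<in> C" and s: "s \<in> E" for c s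
  proof -
    obtain g i where gi: "s = (g, i)" by (rule prod.exhaust)
    have g: "g \<in> carrier G" using s by (simp add: gi E_def)
    obtain h j where hj: "\<tau> s = (h, j)" by (rule prod.exhaust)
    have h: "h \<in> carrier G" using bij_betw_apply[OF \<tau> s] by (simp add: hj E_def)
    have cc: "c \<in> carrier G" "\<iota> c \<in> carrier G"
      using c subgroup.mem_carrier[OF C] subgroup.mem_carrier[OF D] by auto
    have E': "apfst ((\<otimes>) (\<iota> c)) s \<in> E" "apfst ((\<otimes>) c) (\<tau> s) \<in> E"
      unfolding hj unfolding gi E_def using g h cc by simp_all
    obtain d k where dk: "coset_split G ?D s = (d, k)" by (rule prod.exhaust)
    have "d \<in> ?D" using bij_betw_apply[OF splD s] by (simp add: dk)
    then obtain e where e: "e \<in> C" "d = \<iota> e" by blast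
    have "\<iota> c \<otimes> d = \<iota> (c \<otimes> e)" using \<iota>.hom_mult[of c e] c e by simp
    then have \<kappa>_mult: "?\<kappa> (\<iota> c \<otimes> d) = c \<otimes> ?\<kappa> d"
      using inj c e subgroup.m_closed[OF C] by (simp add: inv_into_f_f)
    have "coset_split G ?D (apfst ((\<otimes>) (\<iota> c)) s) = (\<iota> c \<otimes> d, k)"
      using coset_split_act[OF D imageI[OF c] g, of i] dk by (simp add: gi)
    with split_\<tau>[OF E'(1)] have "coset_split G C (\<tau> (apfst ((\<otimes>) (\<iota> c)) s)) = (c \<otimes> ?\<kappa> d, \<beta> k)"
      by (simp add: \<kappa>_mult)
    moreover have "coset_split G C (apfst ((\<otimes>) c) (\<tau> s)) = (c \<otimes> ?\<kappa> d, \<beta> k)"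
      using coset_split_act[OF C c h, of j] split_\<tau>[OF s] dk by (simp add: hj)
    ultimately show ?thesis
      by (intro inj_onD[OF bij_betw_imp_inj_on[OF splC] _ bij_betw_apply[OF \<tau> E'(1)] E'(2)]) simp
  qed
  have ping: "\<tau> s \<in> C \<times> ping_index True \<longleftrightarrow> s \<notin> ?D \<times> ping_index False" if s: "s \<in> E" for s
  proof -
    \<comment> \<open>The coset of an element is \<open>B\<close> exactly when the element lies in
      \<open>B\<close>. Membership in \<open>B \<times> J\<close> is thus a property of the orbit,
      which \<open>\<beta>_ping\<close> controls.\<close>
    have split_mem: "s' \<in> B \<times> J \<longleftrightarrow> snd (coset_split G B s') \<in> {B} \<times> J"
      if "subgroup B G" "s' \<in> E" for B J s'
      using that rcos_eq_iff_mem[OF that(1), of "fst s'"]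
      by (cases s') (auto simp: coset_split_def E_def)
    have "snd (coset_split G ?D s) \<in> (rcosets ?D) \<times> ?I"
      using bij_betw_apply[OF splD s] by (simp only: mem_Times_iff)
    from \<beta>_ping[OF this] show ?thesis
      unfolding split_mem[OF C bij_betw_apply[OF \<tau> s]] split_mem[OF D s] split_\<tau>[OF s]
      by (simp only: snd_map_prod)
  qed
  show ?thesis by (intro exI[of _ \<tau>] conjI ballI \<tau> act ping)
qed

section \<open>Universal property, generation and stable relation of a splitting\<close>

lemma splits_as_hnn_hom:
  assumes H: "group H" and split: "splits_as_hnn H A C \<iota> t" and M: "group M"
    and f: "f \<in> hnn_gens (H\<lparr>carrier := A\<rparr>) \<rightarrow> carrier M"
    and mult: "\<And>a b. a \<in> A \<Longrightarrow> b \<in> A \<Longrightarrow>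
      f (Vertex (a \<otimes>\<^bsub>H\<^esub> b)) = f (Vertex a) \<otimes>\<^bsub>M\<^esub> f (Vertex b)"
    and stable: "\<And>c. c \<in> C \<Longrightarrow>
      f (Vertex c) \<otimes>\<^bsub>M\<^esub> f Stable = f Stable \<otimes>\<^bsub>M\<^esub> f (Vertex (\<iota> c))"
  shows "\<exists>\<rho>\<in>hom H M. (\<forall>a\<in>A. \<rho> a = f (Vertex a)) \<and> \<rho> t = f Stable"
proof -
  let ?A = "H\<lparr>carrier := A\<rparr>"
  let ?P = "hnn_extension ?A C \<iota>" and ?q = "hnn_class ?A C \<iota>"
  let ?X = "hnn_gens ?A" and ?R = "hnn_relators ?A C \<iota>"
  from split obtain \<psi> where \<psi>: "\<psi> \<in> iso ?P H"
    and \<psi>_Vertex: "\<And>a. a \<in> A \<Longrightarrow> \<psi> (?q (Vertex a)) = a" and \<psi>_Stable: "\<psi> (?q Stable) = t"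
    unfolding splits_as_hnn_def by blast
  have rel: "word_eval M f r = \<one>\<^bsub>M\<^esub>" if "r \<in> ?R" "r \<in> words ?X" for r
    by (rule hnn_relator_eval[OF M f _ _ that]) (use mult stable in simp_all)
  let ?h = "presented_hom M f" and ?i = "inv_into (carrier ?P) \<psi>"
  have h: "?h \<in> hom ?P M"
    unfolding hnn_extension_def by (rule group.presented_hom_in_hom[OF M f rel])
  have h_gen: "?h (?q x) = f x" if "x \<in> ?X" for x
    unfolding hnn_class_def by (rule group.presented_hom_generator[OF M f rel that])
  have i: "?i \<in> hom H ?P"
    using group.iso_set_sym[OF group_hnn_extension \<psi>] by (simp add: iso_def)
  have inj: "inj_on \<psi> (carrier ?P)" using \<psi> by (simp add: iso_def bij_betw_def)
  have q: "?q x \<in> carrier ?P" if "x \<in> ?X" for x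
    using hnn_class_closed[of ?A C \<iota>] that by (rule funcset_mem)
  have val: "(?h \<circ> ?i) (\<psi> (?q x)) = f x" if "x \<in> ?X" for x
    using inv_into_f_f[OF inj q[OF that]] h_gen[OF that] by simp
  show ?thesis
  proof (intro bexI[of _ "?h \<circ> ?i"] conjI ballI)
    show "?h \<circ> ?i \<in> hom H M" by (rule hom_compose[OF i h])
    show "(?h \<circ> ?i) a = f (Vertex a)" if "a \<in> A" for a
      using val[of "Vertex a"] \<psi>_Vertex[OF that] that by (simp add: hnn_gens_def)
    show "(?h \<circ> ?i) t = f Stable"
      using val[of Stable] \<psi>_Stable by (simp add: hnn_gens_def)
  qed
qed

lemma splits_as_hnn_generate:
  assumes H: "group H" and split: "splits_as_hnn H A C \<iota> t"
  shows "generate H (insert t A) = carrier H"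
proof -
  let ?A = "H\<lparr>carrier := A\<rparr>"
  let ?P = "hnn_extension ?A C \<iota>" and ?q = "hnn_class ?A C \<iota>"
  from split obtain \<psi> where \<psi>: "\<psi> \<in> iso ?P H"
    and \<psi>_Vertex: "\<And>a. a \<in> A \<Longrightarrow> \<psi> (?q (Vertex a)) = a" and \<psi>_Stable: "\<psi> (?q Stable) = t"
    unfolding splits_as_hnn_def by blast
  interpret \<psi>: group_hom ?P H \<psi>
    using \<psi> group_hnn_extension H by (simp add: group_hom_def group_hom_axioms_def iso_def)
  let ?B = "insert (?q Stable) ((\<lambda>a. ?q (Vertex a)) ` A)"
  have B: "?B \<subseteq> carrier ?P"
    using hnn_class_closed[of ?A C \<iota>] by (auto simp: hnn_gens_def)
  have "\<psi> ` ?B = insert t A"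
    using \<psi>_Vertex \<psi>_Stable by (simp add: image_image)
  then have "generate H (insert t A) = \<psi> ` generate ?P ?B"
    using \<psi>.generate_img[OF B] by simp
  also have "generate ?P ?B = carrier ?P"
    using generate_hnn_class[of ?A C \<iota>] by simp
  also have "\<psi> ` carrier ?P = carrier H" using \<psi> by (simp add: iso_def bij_betw_def)
  finally show ?thesis .
qed

lemma splits_as_hnn_conj:
  assumes H: "group H" and split: "splits_as_hnn H A C \<iota> t" and c: "c \<in> C"
  shows "c \<otimes>\<^bsub>H\<^esub> t = t \<otimes>\<^bsub>H\<^esub> \<iota> c"
proof -
  let ?A = "H\<lparr>carrier := A\<rparr>"
  let ?P = "hnn_extension ?A C \<iota>" and ?q = "hnn_class ?A C \<iota>"
  from split obtain \<psi> where \<psi>: "\<psi> \<in> iso ?P H"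
    and \<psi>_Vertex: "\<And>a. a \<in> A \<Longrightarrow> \<psi> (?q (Vertex a)) = a" and \<psi>_Stable: "\<psi> (?q Stable) = t"
    unfolding splits_as_hnn_def by blast
  have hom: "\<psi> \<in> hom ?P H" using \<psi> by (simp add: iso_def)
  have C: "subgroup C ?A" and \<iota>: "\<iota> \<in> mon (H\<lparr>carrier := C\<rparr>) ?A"
    using split by (simp_all add: splits_as_hnn_def)
  have cA: "c \<in> A" "\<iota> c \<in> A"
    using subgroup.mem_carrier[OF C c] \<iota> c by (auto simp: mon_def hom_def)
  have q: "?q (Vertex c) \<in> carrier ?P" "?q (Vertex (\<iota> c)) \<in> carrier ?P" "?q Stable \<in> carrier ?P"
    using hnn_class_closed[of ?A C \<iota>] cA by (auto simp: hnn_gens_def)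
  have "?q (Vertex c) \<otimes>\<^bsub>?P\<^esub> ?q Stable = ?q Stable \<otimes>\<^bsub>?P\<^esub> ?q (Vertex (\<iota> c))"
    using hnn_class_Stable_conj[OF c, of ?A \<iota>] cA by simp
  from arg_cong[OF this, of \<psi>] show ?thesis
    unfolding hom_mult[OF hom q(1,3)] hom_mult[OF hom q(3,2)]
    by (simp only: \<psi>_Vertex[OF cA(1)] \<psi>_Vertex[OF cA(2)] \<psi>_Stable)
qed

section \<open>Free subgroups of non-ascending splittings\<close>

lemma (in group) left_mult_Bij:
  assumes a: "a \<in> carrier G"
  shows "(\<lambda>s\<in>carrier G \<times> I. apfst ((\<otimes>) a) s) \<in> Bij (carrier G \<times> I)"
proof -
  have "bij_betw (apfst ((\<otimes>) a)) (carrier G \<times> I) (carrier G \<times> I)"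
    by (rule bij_betw_byWitness[where f' = "apfst ((\<otimes>) (inv a))"]) (use a in auto)
  then show ?thesis by (simp add: Bij_def)
qed

text \<open>The stable letter \<open>t\<close> and its conjugate \<open>a t a\<^sup>-\<^sup>1\<close> play ping-pong.\<close>

lemma splits_as_hnn_nonascending:
  assumes H: "group H" and split: "splits_as_hnn H A C \<iota> t"
    and a: "a \<in> A" "a \<notin> C" "a \<notin> \<iota> ` C"
  shows "contains_nonabelian_free_subgroup H"
proof -
  let ?A = "H\<lparr>carrier := A\<rparr>"
  interpret H: group H by (rule H)
  have A: "subgroup A H" and C: "subgroup C ?A" and t: "t \<in> carrier H"
    and \<iota>: "\<iota> \<in> mon (?A\<lparr>carrier := C\<rparr>) ?A"
    using split by (simp_all add: splits_as_hnn_def)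
  interpret A: group ?A by (rule H.subgroup_imp_group[OF A])
  note Ac = subgroup.mem_carrier[OF A]
  let ?I = "UNIV :: 'a set index set"
  define E where "E = A \<times> ?I"
  obtain \<tau> where \<tau>: "bij_betw \<tau> E E"
    and \<tau>_act: "\<And>c s. c \<in> C \<Longrightarrow> s \<in> E \<Longrightarrow> \<tau> (apfst ((\<otimes>\<^bsub>H\<^esub>) (\<iota> c)) s) = apfst ((\<otimes>\<^bsub>H\<^esub>) c) (\<tau> s)"
    and \<tau>_ping: "\<And>s. s \<in> E \<Longrightarrow> \<tau> s \<in> C \<times> ping_index True \<longleftrightarrow> s \<notin> \<iota> ` C \<times> ping_index False"
    using A.exists_stable_permutation[OF C \<iota>] unfolding E_def by auto
  \<comment> \<open>Vertex elements act by left multiplication on the first component and the stable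
    letter acts by \<open>\<tau>\<close>. Both are restricted because members of
    \<open>Bij E\<close> are extensional.\<close>
  let ?f = "\<lambda>x. case x of Vertex a \<Rightarrow> (\<lambda>s\<in>E. apfst ((\<otimes>\<^bsub>H\<^esub>) a) s) | Stable \<Rightarrow> restrict \<tau> E"
  have f_Vertex: "?f (Vertex b) \<in> Bij E" if "b \<in> A" for b
    using A.left_mult_Bij[of b ?I] that by (simp add: E_def)
  have f_Stable: "?f Stable \<in> Bij E" using \<tau> by (simp add: Bij_def)
  have CA: "c \<in> A" "\<iota> c \<in> A" if "c \<in> C" for c
    using subgroup.mem_carrier[OF C that] \<iota> that by (auto simp: mon_def hom_def)
  have mult_E: "apfst ((\<otimes>\<^bsub>H\<^esub>) b) s \<in> E" if "b \<in> A" "s \<in> E" for b s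
    using that subgroup.m_closed[OF A] by (cases s) (simp add: E_def)
  have \<tau>_E: "\<tau> s \<in> E" if "s \<in> E" for s by (rule bij_betw_apply[OF \<tau> that])
  have "\<exists>\<rho>\<in>hom H (BijGroup E). (\<forall>a\<in>A. \<rho> a = ?f (Vertex a)) \<and> \<rho> t = ?f Stable"
  proof (rule splits_as_hnn_hom[OF H split group_BijGroup])
    show "?f \<in> hnn_gens ?A \<rightarrow> carrier (BijGroup E)"
    proof
      fix x assume "x \<in> hnn_gens ?A"
      then show "?f x \<in> carrier (BijGroup E)"
        using f_Vertex f_Stable by (cases x) (auto simp: hnn_gens_def BijGroup_def)
    qed
  next
    fix b c assume bc: "b \<in> A" "c \<in> A"
    have "?f (Vertex (b \<otimes>\<^bsub>H\<^esub> c)) = compose E (?f (Vertex b)) (?f (Vertex c))"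
    proof
      fix s
      show "?f (Vertex (b \<otimes>\<^bsub>H\<^esub> c)) s = compose E (?f (Vertex b)) (?f (Vertex c)) s"
      proof (cases "s \<in> E")
        case True
        then show ?thesis
          using mult_E[OF bc(2) True] bc Ac
          by (cases s) (simp add: compose_def E_def H.m_assoc)
      qed (simp add: compose_def)
    qed
    then show "?f (Vertex (b \<otimes>\<^bsub>H\<^esub> c)) = ?f (Vertex b) \<otimes>\<^bsub>BijGroup E\<^esub> ?f (Vertex c)"
      using f_Vertex[OF bc(1)] f_Vertex[OF bc(2)] by (simp add: BijGroup_def)
  next
    fix c assume c: "c \<in> C"
    have "compose E (?f (Vertex c)) (?f Stable) = compose E (?f Stable) (?f (Vertex (\<iota> c)))"
    proof
      fix s
      show "compose E (?f (Vertex c)) (?f Stable) s = compose E (?f Stable) (?f (Vertex (\<iota> c))) s"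
        using \<tau>_act[OF c, of s] mult_E[OF CA(2)[OF c], of s] \<tau>_E[of s]
        by (cases "s \<in> E") (simp_all add: compose_def)
    qed
    then show "?f (Vertex c) \<otimes>\<^bsub>BijGroup E\<^esub> ?f Stable = ?f Stable \<otimes>\<^bsub>BijGroup E\<^esub> ?f (Vertex (\<iota> c))"
      using f_Vertex[OF CA(1)[OF c]] f_Vertex[OF CA(2)[OF c]] f_Stable by (simp add: BijGroup_def)
  qed
  then obtain \<rho> where \<rho>: "\<rho> \<in> hom H (BijGroup E)"
    and \<rho>_Vertex: "\<And>b. b \<in> A \<Longrightarrow> \<rho> b = (\<lambda>s\<in>E. apfst ((\<otimes>\<^bsub>H\<^esub>) b) s)" and \<rho>_Stable: "\<rho> t = restrict \<tau> E"
    by auto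
  interpret act: group_action H E \<rho>
    using \<rho> H group_BijGroup by (simp add: group_action_def group_hom_def group_hom_axioms_def)
  have act_E: "\<rho> g s \<in> E" if "g \<in> carrier H" "s \<in> E" for g s
    by (rule act.element_image[OF that HOL.refl])
  have act_inv: "\<rho> (inv\<^bsub>H\<^esub> g) (\<rho> g s) = s" "\<rho> g (\<rho> (inv\<^bsub>H\<^esub> g) s) = s" if "g \<in> carrier H" "s \<in> E" for g s
    using act.orbit_sym_aux[OF that HOL.refl] act.orbit_sym_aux[of "inv\<^bsub>H\<^esub> g" s] that by simp_all
  define S where "S b = (if b then C else \<iota> ` C)" for b
  have S: "subgroup (S b) ?A" for b
  proof -
    interpret \<iota>: group_hom "?A\<lparr>carrier := C\<rparr>" ?A \<iota>
      using \<iota> A.subgroup_imp_group[OF C] A.is_group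
      by (simp add: group_hom_def group_hom_axioms_def mon_def)
    show ?thesis using C \<iota>.img_is_subgroup by (simp add: S_def)
  qed
  have a_S: "a \<notin> S b" for b using a by (simp add: S_def)
  \<comment> \<open>\<open>U True\<close> attracts \<open>t\<close> and \<open>U False\<close> its
    inverse; their translates by \<open>a\<close> will attract the conjugate and its
    inverse.\<close>
  define U where "U b = S b \<times> (ping_index b :: 'a set index set)" for b
  have aH: "a \<in> carrier H" "inv\<^bsub>H\<^esub> a \<in> carrier H" "inv\<^bsub>H\<^esub> a \<in> A"
    using a Ac subgroup.m_inv_closed[OF A] by simp_all
  have t_ping: "\<rho> (letter_eval H (\<lambda>x. x) (t, b)) s \<in> U b" if s: "s \<in> E" "s \<notin> U (\<not> b)" for s b
  proof (cases b)
    case True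
    then show ?thesis
      using \<tau>_ping[OF s(1)] s by (simp add: letter_eval_def \<rho>_Stable U_def S_def)
  next
    case False
    \<comment> \<open>For the inverse of \<open>t\<close>, the equivalence
      \<open>\<tau>_ping\<close> is read backwards at the preimage \<open>?s\<close>: as
      \<open>\<tau> ?s = s\<close> avoids \<open>U True\<close>, the point \<open>?s\<close> lies in
      \<open>U False\<close>.\<close>
    let ?s = "\<rho> (inv\<^bsub>H\<^esub> t) s"
    have "?s \<in> E" using act_E t s by simp
    moreover have "\<tau> ?s = s" using act_inv(2)[OF t s(1)] calculation by (simp add: \<rho>_Stable)
    ultimately show ?thesis
      using \<tau>_ping[of ?s] s False by (simp add: letter_eval_def U_def S_def)
  qed
  have U_disj: "b = b'" if "s \<in> U b" "s \<in> U b'" for s b b'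
    using that ping_index_unique[of "snd s" b b'] by (simp add: U_def mem_Times_iff)
  \<comment> \<open>No \<open>U b\<close> meets the translate of a \<open>U b'\<close> by
    \<open>a\<close>: vertex elements preserve indices, so \<open>b = b'\<close>, and two elements
    \<open>g\<close> and \<open>inv a\<close> times \<open>g\<close> of the subgroup
    \<open>S b\<close> would put \<open>a\<close> into it.\<close>
  have aU_disj: False if s: "s \<in> E" "s \<in> U b" "\<rho> (inv\<^bsub>H\<^esub> a) s \<in> U b'" for s b b'
  proof -
    obtain g i where gi: "s = (g, i)" by (rule prod.exhaust)
    have g: "g \<in> A" using s(1) by (simp add: gi E_def)
    have eq: "\<rho> (inv\<^bsub>H\<^esub> a) s = (inv\<^bsub>H\<^esub> a \<otimes>\<^bsub>H\<^esub> g, i)" using s(1) aH by (simp add: \<rho>_Vertex gi)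
    have m: "g \<in> S b" "i \<in> ping_index b" using s(2) by (simp_all add: gi U_def)
    have m': "inv\<^bsub>H\<^esub> a \<otimes>\<^bsub>H\<^esub> g \<in> S b'" "i \<in> ping_index b'"
      using s(3) unfolding eq by (simp_all add: U_def)
    have "b' = b" by (rule ping_index_unique[OF m'(2) m(2)])
    with m(1) m'(1) have gS: "g \<in> S b" "inv\<^bsub>H\<^esub> a \<otimes>\<^bsub>H\<^esub> g \<in> S b" by simp_all
    have "g \<otimes>\<^bsub>H\<^esub> inv\<^bsub>H\<^esub> (inv\<^bsub>H\<^esub> a \<otimes>\<^bsub>H\<^esub> g) = a"
      using Ac[OF g] aH by (simp add: H.inv_mult_group)
    moreover have "inv\<^bsub>H\<^esub> (inv\<^bsub>H\<^esub> a \<otimes>\<^bsub>H\<^esub> g) \<in> S b"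
      using subgroup.m_inv_closed[OF S gS(2)] H.m_inv_consistent[OF A] aH(3) g subgroup.m_closed[OF A]
      by simp
    then have "g \<otimes>\<^bsub>H\<^esub> inv\<^bsub>H\<^esub> (inv\<^bsub>H\<^esub> a \<otimes>\<^bsub>H\<^esub> g) \<in> S b"
      using subgroup.m_closed[OF S gS(1)] by simp
    ultimately show False using a_S by simp
  qed
  let ?y = "a \<otimes>\<^bsub>H\<^esub> t \<otimes>\<^bsub>H\<^esub> inv\<^bsub>H\<^esub> a"
  have y: "?y \<in> carrier H" using aH t by simp
  have y_ping: "\<rho> (inv\<^bsub>H\<^esub> a) (\<rho> (letter_eval H (\<lambda>x. x) (?y, b)) s) \<in> U b"
    if s: "s \<in> E" "\<rho> (inv\<^bsub>H\<^esub> a) s \<notin> U (\<not> b)" for s b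
  proof -
    let ?l = "letter_eval H (\<lambda>x. x) (t, b)"
    have l: "?l \<in> carrier H" using t by (simp add: letter_eval_def)
    have "letter_eval H (\<lambda>x. x) (?y, b) = a \<otimes>\<^bsub>H\<^esub> (?l \<otimes>\<^bsub>H\<^esub> inv\<^bsub>H\<^esub> a)"
      using aH t by (simp add: letter_eval_def H.inv_mult_group H.m_assoc)
    then have "\<rho> (letter_eval H (\<lambda>x. x) (?y, b)) s = \<rho> a (\<rho> ?l (\<rho> (inv\<^bsub>H\<^esub> a) s))"
      using act.composition_rule[OF s(1)] l aH by simp
    moreover have s': "\<rho> (inv\<^bsub>H\<^esub> a) s \<in> E" by (rule act_E[OF aH(2) s(1)])
    ultimately show ?thesis
      using act_inv(1)[OF aH(1) act_E[OF l s']] t_ping[OF s' s(2)] by simp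
  qed
  \<comment> \<open>The residue \<open>2\<close> belongs to neither ping index set, and
    \<open>a\<close> does not move indices, so \<open>p\<close> avoids all four attracting
    sets.\<close>
  define p where "p = (\<one>\<^bsub>H\<^esub>, [] :: 'a set list, 2 :: nat)"
  have pE: "p \<in> E" using subgroup.one_closed[OF A] by (simp add: p_def E_def)
  have p_U: "p \<notin> U b" for b by (simp add: p_def U_def ping_index_def)
  have ap_U: "\<rho> (inv\<^bsub>H\<^esub> a) p \<notin> U b" for b
    using pE aH by (simp add: \<rho>_Vertex) (simp add: p_def U_def ping_index_def)
  \<comment> \<open>If the two were equal, the image of \<open>p\<close> under \<open>t\<close>
    would lie both in \<open>U True\<close> and in its translate by \<open>a\<close>.\<close>
  have ty: "t \<noteq> ?y"
  proof
    assume eq: "t = ?y"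
    have "\<rho> t p \<in> U True" using t_ping[OF pE, of True] p_U by (simp add: letter_eval_def)
    moreover have "\<rho> (inv\<^bsub>H\<^esub> a) (\<rho> ?y p) \<in> U True"
      using y_ping[OF pE, of True] ap_U by (simp add: letter_eval_def)
    ultimately show False
      using aU_disj[OF act_E[OF t pE]] unfolding eq[symmetric] by blast
  qed
  \<comment> \<open>Membership in a translate by \<open>a\<close> is tested by pulling
    \<open>s\<close> back with the inverse of \<open>a\<close>.\<close>
  define D where "D l = {s \<in> E. (if fst l = t then s else \<rho> (inv\<^bsub>H\<^esub> a) s) \<in> U (snd l)}" for l :: "'a \<times> bool"
  show ?thesis
  proof (rule ping_pong[where X = "{t, ?y}" and D = D and p = p])
    show "group_action H E \<rho>" by (rule act.group_action_axioms)
    show "{t, ?y} \<subseteq> carrier H" using t y by blast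
  next
    fix l :: "'a \<times> bool" and s assume l: "fst l \<in> {t, ?y}" and s: "s \<in> E" "s \<notin> D (fst l, \<not> snd l)"
    have "letter_eval H (\<lambda>x. x) l \<in> carrier H" using l t y by (auto simp: letter_eval_def)
    then have in_E: "\<rho> (letter_eval H (\<lambda>x. x) l) s \<in> E" using act_E s(1) by blast
    show "\<rho> (letter_eval H (\<lambda>x. x) l) s \<in> D l"
    proof (cases "fst l = t")
      case True
      then show ?thesis
        using t_ping[OF s(1), of "snd l"] s in_E unfolding D_def by (cases l) simp
    next
      case False
      then have "fst l = ?y" using l by blast
      then show ?thesis
        using False y_ping[OF s(1), of "snd l"] s in_E unfolding D_def by (cases l) simp
    qed
  next
    fix l l' :: "'a \<times> bool" and s
    assume l: "fst l \<in> {t, ?y}" "fst l' \<in> {t, ?y}" and s: "s \<in> D l" "s \<in> D l'"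
    have sE: "s \<in> E" and u: "(if fst l = t then s else \<rho> (inv\<^bsub>H\<^esub> a) s) \<in> U (snd l)"
        "(if fst l' = t then s else \<rho> (inv\<^bsub>H\<^esub> a) s) \<in> U (snd l')"
      using s unfolding D_def by simp_all
    have same: "fst l = t \<longleftrightarrow> fst l' = t"
    proof (rule ccontr)
      assume "\<not> ?thesis"
      then consider "fst l = t" "fst l' \<noteq> t" | "fst l \<noteq> t" "fst l' = t" by blast
      then show False
      proof cases
        case 1
        then show False using aU_disj[OF sE, of "snd l" "snd l'"] u by simp
      next
        case 2
        then show False using aU_disj[OF sE, of "snd l'" "snd l"] u by simp
      qed
    qed
    then have "fst l = fst l'" using l by (cases "fst l = t") auto
    moreover have "snd l = snd l'" using u unfolding same by (rule U_disj)
    ultimately show "l = l'" by (simp add: prod_eq_iff)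
  next
    show "p \<in> E" by (rule pE)
    show "p \<notin> D l" for l using p_U ap_U by (simp add: D_def)
    show "t \<in> {t, ?y}" "?y \<in> {t, ?y}" "t \<noteq> ?y" using ty by simp_all
  qed
qed

section \<open>Passing to quotients\<close>

text \<open>Otherwise the product of an element outside \<open>C\<close> and an element outside
  \<open>D\<close> would lie in neither subgroup.\<close>

lemma (in group) union_of_subgroups:
  assumes "subgroup C G" "subgroup D G" "carrier G \<subseteq> C \<union> D"
  shows "C = carrier G \<or> D = carrier G"
proof (rule ccontr)
  assume "\<not> ?thesis"
  then obtain c d where c: "c \<in> carrier G" "c \<notin> C" and d: "d \<in> carrier G" "d \<notin> D"
    using subgroup.subset[OF assms(1)] subgroup.subset[OF assms(2)] by blast
  then have cd: "c \<in> D" "d \<in> C" using assms(3) by blast+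
  have "c \<otimes> d \<in> C \<or> c \<otimes> d \<in> D" using c d assms(3) by blast
  then show False
  proof
    assume "c \<otimes> d \<in> C"
    then have "(c \<otimes> d) \<otimes> inv d \<in> C"
      using subgroup.m_closed[OF assms(1)] subgroup.m_inv_closed[OF assms(1) cd(2)] by blast
    then show False using c d by (simp add: m_assoc)
  next
    assume "c \<otimes> d \<in> D"
    then have "inv c \<otimes> (c \<otimes> d) \<in> D"
      using subgroup.m_closed[OF assms(2)] subgroup.m_inv_closed[OF assms(2) cd(1)] by blast
    then show False using c d by simp
  qed
qed

lemma (in group) normal_closure_normal: "normal_closure G A \<lhd> G" if "A \<subseteq> carrier G"
proof (rule normal_invI)
  let ?F = "{N. N \<lhd> G \<and> A \<subseteq> N}"
  have "carrier G \<in> ?F" using that by (simp add: normal_invI subgroup_self)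
  then have "?F \<noteq> {}" by (metis empty_iff)
  then show "subgroup (normal_closure G A) G"
    unfolding normal_closure_def by (rule subgroups_Inter[rotated]) (simp add: normal_imp_subgroup)
  fix x h assume x: "x \<in> carrier G" and h: "h \<in> normal_closure G A"
  show "x \<otimes> h \<otimes> inv x \<in> normal_closure G A"
    unfolding normal_closure_def
  proof (rule InterI)
    fix N assume N: "N \<in> ?F"
    then have "h \<in> N" using h unfolding normal_closure_def by (rule InterD[rotated])
    with N x show "x \<otimes> h \<otimes> inv x \<in> N" by (simp add: normal.inv_op_closed2)
  qed
qed

lemma realises_values:
  assumes H: "group H" and A: "A \<subseteq> carrier H" and t: "t \<in> carrier H" and real: "realises H A t \<phi>"
  shows "a \<in> A \<Longrightarrow> \<phi> a = 0" "\<phi> t = 1 \<or> \<phi> t = - 1"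
proof -
  let ?K = "normal_closure H A"
  interpret H: group H by (rule H)
  interpret K: normal ?K H by (rule H.normal_closure_normal[OF A])
  from real obtain \<theta> where \<theta>: "\<theta> \<in> iso (H Mod ?K) integer_group"
    and \<theta>_t: "\<theta> (?K #>\<^bsub>H\<^esub> t) = 1 \<or> \<theta> (?K #>\<^bsub>H\<^esub> t) = - 1"
    and \<phi>: "\<And>h. h \<in> carrier H \<Longrightarrow> \<phi> h = \<theta> (?K #>\<^bsub>H\<^esub> h)"
    unfolding realises_def by blast
  show "\<phi> t = 1 \<or> \<phi> t = - 1" using \<theta>_t \<phi>[OF t] by simp
  assume a: "a \<in> A"
  then have "a \<in> ?K" by (auto simp: normal_closure_def)
  then have "?K #>\<^bsub>H\<^esub> a = ?K" using H.coset_join2[OF _ K.subgroup_axioms] A a by blast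
  moreover have "\<theta> \<one>\<^bsub>H Mod ?K\<^esub> = \<one>\<^bsub>integer_group\<^esub>"
    using \<theta> by (intro hom_one[OF _ K.factorgroup_is_group group_integer_group]) (simp add: iso_def)
  ultimately show "\<phi> a = 0" using \<phi> A a by (auto simp: FactGroup_def)
qed

text \<open>Generation passes along the surjection, the conjugation condition along any
  homomorphism, and the values of the map to the integers are carried over by
  \<open>eq\<close>.\<close>

lemma ascending_image:
  assumes asc: "ascending H A t \<phi>" and hom: "group_hom H K h" and surj: "h ` carrier H = carrier K"
    and \<psi>: "\<psi> \<in> hom K integer_group" and eq: "\<And>x. x \<in> carrier H \<Longrightarrow> \<psi> (h x) = \<phi> x"
  shows "ascending K (h ` A) (h t) \<psi>"
proof -
  interpret ascending H A t \<phi> by (rule asc)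
  interpret h: group_hom H K h by (rule hom)
  note Ac = subgroup.mem_carrier[OF A]
  show ?thesis
  proof (intro ascending.intro ascending_axioms.intro)
    show "group K" by (rule h.H.is_group)
    show "subgroup (h ` A) K" by (rule h.subgroup_img_is_subgroup[OF A])
    show "h t \<in> carrier K" using t by simp
    show "\<psi> \<in> hom K integer_group" by (rule \<psi>)
    show "inv\<^bsub>K\<^esub> h t \<otimes>\<^bsub>K\<^esub> b \<otimes>\<^bsub>K\<^esub> h t \<in> h ` A" if b: "b \<in> h ` A" for b
    proof -
      obtain a where a: "a \<in> A" "b = h a" using b by blast
      have "inv\<^bsub>K\<^esub> h t \<otimes>\<^bsub>K\<^esub> b \<otimes>\<^bsub>K\<^esub> h t = h (inv\<^bsub>H\<^esub> t \<otimes>\<^bsub>H\<^esub> a \<otimes>\<^bsub>H\<^esub> t)"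
        using t Ac[OF a(1)] by (simp add: a(2))
      then show ?thesis using conj[OF a(1)] by blast
    qed
    have "insert t A \<subseteq> carrier H" using t Ac by blast
    from h.generate_img[OF this] show "generate K (insert (h t) (h ` A)) = carrier K"
      using gen surj by simp
    show "\<psi> b = 0" if "b \<in> h ` A" for b
      using that eq Ac \<phi>_A by auto
    show "\<psi> (h t) = 1 \<or> \<psi> (h t) = - 1"
      using eq[OF t] \<phi>_t by simp
  qed
qed

lemma finitely_generated_image:
  assumes "group_hom H K h" "finitely_generated H"
  shows "finitely_generated (K\<lparr>carrier := h ` carrier H\<rparr>)"
proof -
  interpret h: group_hom H K h by fact
  obtain S where S: "finite S" "S \<subseteq> carrier H" "generate H S = carrier H"
    using assms(2) unfolding finitely_generated_def by blast
  have "generate (K\<lparr>carrier := h ` carrier H\<rparr>) (h ` S) = generate K (h ` S)"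
    using S(2) h.img_is_subgroup by (intro h.H.generate_consistent) auto
  also have "\<dots> = h ` carrier H" using h.generate_img[OF S(2)] S(3) by simp
  finally show ?thesis
    unfolding finitely_generated_def using S(1,2) by (intro exI[of _ "h ` S"]) auto
qed

text \<open>By \<open>splits_as_hnn_nonascending\<close>, \<open>A\<close> is covered by
  \<open>C\<close> and its image under \<open>\<iota>\<close>, so one of these is all of
  \<open>A\<close>. If it is \<open>C\<close>, then \<open>t\<close> itself serves as
  \<open>t'\<close>; if it is the image, the inverse of \<open>t\<close> does, and
  \<open>\<phi>\<close> again takes the value 1 or -1 there.\<close>

lemma splits_as_hnn_ascending:
  assumes H: "group H" and split: "splits_as_hnn H A C \<iota> t"
    and real: "realises H A t \<phi>" and \<phi>: "\<phi> \<in> hom H integer_group"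
    and free: "\<not> contains_nonabelian_free_subgroup H"
  shows "\<exists>t'. ascending H A t' \<phi>"
proof -
  let ?A = "H\<lparr>carrier := A\<rparr>"
  interpret H: group H by (rule H)
  have A: "subgroup A H" and C: "subgroup C ?A" and t: "t \<in> carrier H"
    and \<iota>: "\<iota> \<in> mon (?A\<lparr>carrier := C\<rparr>) ?A"
    using split by (simp_all add: splits_as_hnn_def)
  interpret A: group ?A by (rule H.subgroup_imp_group[OF A])
  interpret \<iota>: group_hom "?A\<lparr>carrier := C\<rparr>" ?A \<iota>
    using \<iota> A.subgroup_imp_group[OF C] A.is_group
    by (simp add: group_hom_def group_hom_axioms_def mon_def)
  note Ac = subgroup.mem_carrier[OF A]
  note vals = realises_values[OF H subgroup.subset[OF A] t real]
  note gen = splits_as_hnn_generate[OF H split]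
  have CA: "c \<in> A" "\<iota> c \<in> A" if "c \<in> C" for c
    using subgroup.mem_carrier[OF C that] \<iota>.hom_closed[of c] that by simp_all
  have D: "subgroup (\<iota> ` C) ?A" using \<iota>.img_is_subgroup by simp
  have "A \<subseteq> C \<union> \<iota> ` C"
    using splits_as_hnn_nonascending[OF H split] free by blast
  then have "C = A \<or> \<iota> ` C = A" using A.union_of_subgroups[OF C D] by simp
  then show ?thesis
  proof
    assume "C = A"
    have "inv\<^bsub>H\<^esub> t \<otimes>\<^bsub>H\<^esub> a \<otimes>\<^bsub>H\<^esub> t \<in> A" if "a \<in> A" for a
    proof -
      have a: "a \<in> C" using that \<open>C = A\<close> by simp
      have "inv\<^bsub>H\<^esub> t \<otimes>\<^bsub>H\<^esub> a \<otimes>\<^bsub>H\<^esub> t = inv\<^bsub>H\<^esub> t \<otimes>\<^bsub>H\<^esub> (t \<otimes>\<^bsub>H\<^esub> \<iota> a)"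
        using splits_as_hnn_conj[OF H split a] t Ac[OF that] by (simp add: H.m_assoc)
      then show ?thesis using t Ac CA(2)[OF a] by simp
    qed
    then have "ascending H A t \<phi>"
      using H A t gen \<phi> vals by (intro ascending.intro ascending_axioms.intro)
    then show ?thesis by blast
  next
    assume D_eq: "\<iota> ` C = A"
    have t': "inv\<^bsub>H\<^esub> t \<in> carrier H" using t by simp
    have "inv\<^bsub>H\<^esub> (inv\<^bsub>H\<^esub> t) \<otimes>\<^bsub>H\<^esub> a \<otimes>\<^bsub>H\<^esub> inv\<^bsub>H\<^esub> t \<in> A" if a: "a \<in> A" for a
    proof -
      obtain c where c: "c \<in> C" "a = \<iota> c" using a D_eq by blast
      have "t \<otimes>\<^bsub>H\<^esub> a \<otimes>\<^bsub>H\<^esub> inv\<^bsub>H\<^esub> t = c"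
        using splits_as_hnn_conj[OF H split c(1), folded c(2)] t Ac[OF a] Ac[OF CA(1)[OF c(1)]]
        by (simp add: H.inv_solve_right')
      then show ?thesis using t CA(1)[OF c(1)] by simp
    qed
    moreover have "generate H (insert (inv\<^bsub>H\<^esub> t) A) = carrier H"
    proof
      let ?B = "insert (inv\<^bsub>H\<^esub> t) A"
      have B: "?B \<subseteq> carrier H" using t' Ac by blast
      show "generate H ?B \<subseteq> carrier H" by (rule H.generate_incl[OF B])
      have "inv\<^bsub>H\<^esub> (inv\<^bsub>H\<^esub> t) \<in> generate H ?B" by (rule generate.inv) simp
      then have "t \<in> generate H ?B" using t by simp
      moreover have "A \<subseteq> generate H ?B" by (auto intro: generate.incl)
      ultimately show "carrier H \<subseteq> generate H ?B"
        using H.generate_subgroup_incl[OF _ H.generate_is_subgroup[OF B], of "insert t A"] gen by simp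
    qed
    moreover have "\<phi> (inv\<^bsub>H\<^esub> t) = 1 \<or> \<phi> (inv\<^bsub>H\<^esub> t) = - 1"
      using vals(2) hom_integer_group_inv[OF H \<phi> t] by auto
    ultimately have "ascending H A (inv\<^bsub>H\<^esub> t) \<phi>"
      using H A t' \<phi> vals(1) by (intro ascending.intro ascending_axioms.intro)
    then show ?thesis by blast
  qed
qed

lemma (in group_hom) hom_restrict:
  assumes "subgroup A G"
  shows "h \<in> hom (G\<lparr>carrier := A\<rparr>) H"
    and "subgroup B H \<Longrightarrow> h ` A \<subseteq> B \<Longrightarrow> h \<in> hom (G\<lparr>carrier := A\<rparr>) (H\<lparr>carrier := B\<rparr>)"
  using subgroup.mem_carrier[OF assms] by (auto intro!: homI simp: image_subset_iff)

theorem proposition3p2: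
  fixes G :: "('a, 'b) monoid_scheme"
  assumes "group G"
    and "indicably_coherent G"
    and "\<not> contains_nonabelian_free_subgroup G"
    and "N \<lhd> G"
  shows "indicably_coherent (G Mod N)"
  unfolding indicably_coherent_def
proof (intro allI impI, elim conjE)
  interpret G: group G by fact
  interpret N: normal N G by fact
  let ?Q = "G Mod N" and ?\<pi> = "\<lambda>g. N #>\<^bsub>G\<^esub> g"
  interpret \<pi>: group_hom G ?Q ?\<pi>
    using N.r_coset_hom_Mod N.factorgroup_is_group G.is_group
    by (simp add: group_hom_def group_hom_axioms_def)
  fix K \<phi>
  assume K: "subgroup K ?Q" and fg: "finitely_generated (?Q\<lparr>carrier := K\<rparr>)"
    and \<phi>: "\<phi> \<in> epi (?Q\<lparr>carrier := K\<rparr>) integer_group"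
  from fg obtain S where S: "finite S" "S \<subseteq> K" "generate (?Q\<lparr>carrier := K\<rparr>) S = K"
    unfolding finitely_generated_def by auto
  have sub: "K \<subseteq> ?\<pi> ` carrier G" using subgroup.subset[OF K] by (auto simp: FactGroup_def RCOSETS_def)
  \<comment> \<open>Only the generators of \<open>K\<close> are lifted, since the full preimage of
    \<open>K\<close> may fail to be finitely generated.\<close>
  then obtain T where T: "T \<subseteq> carrier G" "finite T" "S = ?\<pi> ` T"
    using finite_subset_image[OF S(1) subset_trans[OF S(2) sub]] by blast
  define H where "H = generate G T"
  have H: "subgroup H G" unfolding H_def by (rule G.generate_is_subgroup[OF T(1)])
  have TH: "T \<subseteq> H" unfolding H_def by (auto intro: generate.incl)
  have \<pi>_H: "?\<pi> ` H = K"
    using \<pi>.generate_img[OF T(1)] \<pi>.H.generate_consistent[OF S(2) K] S(3) T(3) by (simp add: H_def)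
  let ?H = "G\<lparr>carrier := H\<rparr>" and ?K = "?Q\<lparr>carrier := K\<rparr>"
  have gH: "group ?H" by (rule G.subgroup_imp_group[OF H])
  have gK: "group ?K" by (rule \<pi>.H.subgroup_imp_group[OF K])
  have fgH: "finitely_generated ?H"
    using G.generate_consistent[OF TH H] T(2) TH H_def unfolding finitely_generated_def by auto
  have \<pi>_hom: "?\<pi> \<in> hom ?H ?K"
    using \<pi>_H by (intro \<pi>.hom_restrict(2) H K) simp
  \<comment> \<open>The pullback of \<open>\<phi>\<close> to \<open>H\<close> is the epimorphism to
    which coherence of \<open>G\<close> is applied; by construction it factors through
    \<open>\<phi>\<close>, as \<open>ascending_image\<close> demands.\<close>
  let ?\<psi> = "\<lambda>g. \<phi> (?\<pi> g)"
  have \<phi>_hom: "\<phi> \<in> hom ?K integer_group" and \<phi>_surj: "\<phi> ` K = UNIV" using \<phi> by (simp_all add: epi_def)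
  have \<psi>_hom: "?\<psi> \<in> hom ?H integer_group"
    using hom_compose[OF \<pi>_hom \<phi>_hom] by (simp add: comp_def)
  have "?\<psi> ` H = UNIV" using \<phi>_surj unfolding \<pi>_H[symmetric] by (simp add: image_image)
  then have "?\<psi> \<in> epi ?H integer_group" using \<psi>_hom by (simp add: epi_def)
  then obtain A C \<iota> t where split: "splits_as_hnn ?H A C \<iota> t"
    and fgA: "finitely_generated (G\<lparr>carrier := A\<rparr>)" and real: "realises ?H A t ?\<psi>"
    using assms(2) H fgH unfolding indicably_coherent_def by blast
  have "\<not> contains_nonabelian_free_subgroup ?H"
    using assms(3) G.incl_subgroup[OF H] unfolding contains_nonabelian_free_subgroup_def by auto
  then obtain t' where asc: "ascending ?H A t' ?\<psi>"
    using splits_as_hnn_ascending[OF gH split real \<psi>_hom] by blast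
  have "ascending ?K (?\<pi> ` A) (?\<pi> t') \<phi>"
    by (rule ascending_image[OF asc _ _ \<phi>_hom])
      (use gH gK \<pi>_hom \<pi>_H in \<open>simp_all add: group_hom_def group_hom_axioms_def\<close>)
  then interpret K: ascending ?K "?\<pi> ` A" "?\<pi> t'" \<phi> .
  have A: "subgroup A G"
    using split G.incl_subgroup[OF H] by (simp add: splits_as_hnn_def)
  have "group_hom (G\<lparr>carrier := A\<rparr>) ?Q ?\<pi>"
    using \<pi>.hom_restrict(1)[OF A] G.subgroup_imp_group[OF A] \<pi>.H.is_group
    by (intro group_hom.intro group_hom_axioms.intro)
  from finitely_generated_image[OF this fgA]
  have "finitely_generated (?Q\<lparr>carrier := ?\<pi> ` A\<rparr>)" by simp
  with K.splits K.realises
  show "\<exists>A C \<iota> t. splits_as_hnn ?K A C \<iota> t \<and> finitely_generated (?Q\<lparr>carrier := A\<rparr>) \<and>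
    realises ?K A t \<phi>"
    by blast
qed

end
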